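(* Let $T_1$ be a tree of order $n_1$ having exactly $r_1$ non-pendent vertices, and let $T_2$ be a tree of diameter at most $3$ and order $n_2$, where $n_1\ge n_2\ge 6$. Let $T$ be a tree obtained from the disjoint union of $T_1$ and $T_2$ by adding an edge between a vertex of $T_1$ and a vertex of $T_2$, and suppose that its order $n=n_1+n_2$ satisfies $n\ge 19$. Let $\sigma_1$ be the number of Laplacian eigenvalues of $T_1$ that are greater than or equal to the average degree $\overline{d}(T_1)=2-\frac{2}{n_1}$. If $\sigma_1=r_1$ and $LE(T_1)\ge 2+\frac{4n_1}{\pi}$, then $$LE(T)\ge \frac{4n}{\pi}+2,$$ and hence $LE(T)\ge LE(P_n)$, where $P_n$ is the path on $n$ vertices.
   Context: For a simple graph $G$ with $n$ vertices and $m$ edges, let $L(G)=D(G)-A(G)$ be its Laplacian matrix ($D(G)$ the diagonal matrix of vertex degrees, $A(G)$ the adjacency matrix), with eigenvalues (the Laplacian eigenvalues of $G$) $\mu_1(G)\ge\mu_2(G)\ge\dots\ge\mu_n(G)=0$, counted with multiplicity. The average degree is $\overline{d}(G)=\frac{2m}{n}$. The Laplacian energy is $LE(G)=\sum_{i=1}^{n}\left|\mu_i(G)-\overline{d}(G)\right|$. A vertex is pendent if its degree is $1$, and non-pendent otherwise. *)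

theory Defs
  imports
    "Graph_Theory.Graph_Theory"
    "Jordan_Normal_Form.Char_Poly"
begin

text \<open>
  A finite simple graph is a \<^locale>\<open>pair_graph\<close>: a finite loop-free digraph whose arc set is a
  symmetric relation, so that an undirected edge \<open>uv\<close> is the pair of arcs \<open>(u, v)\<close>, \<open>(v, u)\<close>.
\<close>

definition graph_edges :: "'a pair_pre_digraph \<Rightarrow> 'a set set" where
  "graph_edges G = {{u, v} | u v. (u, v) \<in> parcs G}"

definition vertex_degree :: "'a pair_pre_digraph \<Rightarrow> 'a \<Rightarrow> nat" where
  "vertex_degree G v = out_degree (with_proj G) v"

definition average_degree :: "'a pair_pre_digraph \<Rightarrow> real" where
  "average_degree G = 2 * real (card (graph_edges G)) / real (card (pverts G))"

definition non_pendent :: "'a pair_pre_digraph \<Rightarrow> 'a set" where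
  "non_pendent G = {v \<in> pverts G. vertex_degree G v \<noteq> 1}"

text \<open>
  The constant \<^const>\<open>tree\<close> cannot be used here: in a symmetric digraph the walk
  \<open>u, v, u\<close> along one edge counts as a \<^const>\<open>pre_digraph.cycle\<close>. The cycles of the undirected
  graph are those with at least three arcs.
\<close>

definition is_tree :: "'a pair_pre_digraph \<Rightarrow> bool" where
  "is_tree G \<longleftrightarrow> pair_graph G \<and> Digraph_Component.connected (with_proj G) \<and>
     \<not> (\<exists>p. pre_digraph.cycle (with_proj G) p \<and> 3 \<le> length p)"

definition graph_distance :: "'a pair_pre_digraph \<Rightarrow> 'a \<Rightarrow> 'a \<Rightarrow> ereal" where
  "graph_distance G u v = wf_digraph.\<mu> (with_proj G) (\<lambda>_. 1) u v"

definition graph_diameter :: "'a pair_pre_digraph \<Rightarrow> ereal" where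
  "graph_diameter G = (SUP u\<in>pverts G. SUP v\<in>pverts G. graph_distance G u v)"

definition join_by_edge ::
  "'a pair_pre_digraph \<Rightarrow> 'a pair_pre_digraph \<Rightarrow> 'a \<Rightarrow> 'a \<Rightarrow> 'a pair_pre_digraph" where
  "join_by_edge G H u v =
     \<lparr> pverts = pverts G \<union> pverts H, parcs = parcs G \<union> parcs H \<union> {(u, v), (v, u)} \<rparr>"

definition path_graph :: "nat \<Rightarrow> nat pair_pre_digraph" where
  "path_graph n =
     \<lparr> pverts = {..<n}, parcs = {(i, j). i < n \<and> j < n \<and> (j = Suc i \<or> i = Suc j)} \<rparr>"

text \<open>Matrices are taken with respect to an enumeration \<open>vs\<close> of the vertices.\<close>

definition degree_matrix :: "'a pair_pre_digraph \<Rightarrow> 'a list \<Rightarrow> real mat" where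
  "degree_matrix G vs =
     mat (length vs) (length vs) (\<lambda>(i, j). if i = j then real (vertex_degree G (vs ! i)) else 0)"

definition adjacency_matrix :: "'a pair_pre_digraph \<Rightarrow> 'a list \<Rightarrow> real mat" where
  "adjacency_matrix G vs =
     mat (length vs) (length vs) (\<lambda>(i, j). if (vs ! i, vs ! j) \<in> parcs G then 1 else 0)"

definition laplacian_matrix :: "'a pair_pre_digraph \<Rightarrow> 'a list \<Rightarrow> real mat" where
  "laplacian_matrix G vs = degree_matrix G vs - adjacency_matrix G vs"

definition vertex_enumeration :: "'a pair_pre_digraph \<Rightarrow> 'a list" where
  "vertex_enumeration G = (SOME vs. distinct vs \<and> set vs = pverts G)"

text \<open>
  The Laplacian eigenvalues with multiplicity. The Laplacian is a real symmetric matrix, so the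
  real roots of its characteristic polynomial are all of its eigenvalues. They do not depend on
  the chosen enumeration, see \<open>laplacian_eigenvalues_eq\<close> below.
\<close>

definition laplacian_eigenvalues :: "'a pair_pre_digraph \<Rightarrow> real multiset" where
  "laplacian_eigenvalues G = proots (char_poly (laplacian_matrix G (vertex_enumeration G)))"

definition laplacian_energy :: "'a pair_pre_digraph \<Rightarrow> real" where
  "laplacian_energy G = (\<Sum>\<mu>\<in>#laplacian_eigenvalues G. \<bar>\<mu> - average_degree G\<bar>)"

lemma char_poly_laplacian_matrix_cong:
  assumes "distinct vs" "distinct ws" "set vs = set ws"
  shows "char_poly (laplacian_matrix G vs) = char_poly (laplacian_matrix G ws)"
proof -
  define n where "n = length vs"
  have len: "length ws = n"
    using assms by (metis n_def distinct_card)
  have "mset ws = mset vs"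
    using assms by (metis set_eq_iff_mset_eq_distinct)
  then obtain p where p: "p permutes {..<length vs}" and ws: "permute_list p vs = ws"
    by (rule mset_eq_permutation)
  have pn: "p permutes {0..<n}"
    using p by (simp add: n_def lessThan_atLeast0)
  have p_less: "p i < n \<longleftrightarrow> i < n" for i
    using permutes_in_image[OF pn, of i] by simp
  have ws_nth: "ws ! i = vs ! p i" if "i < n" for i
    using that p ws by (metis n_def permute_list_nth)
  define A where "A = char_poly_matrix (laplacian_matrix G vs)"
  define B where "B = char_poly_matrix (laplacian_matrix G ws)"
  have L: "laplacian_matrix G vs \<in> carrier_mat n n" "laplacian_matrix G ws \<in> carrier_mat n n"
    by (auto simp: laplacian_matrix_def degree_matrix_def adjacency_matrix_def len n_def
        intro!: minus_carrier_mat)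
  have A: "A \<in> carrier_mat n n" and B: "B \<in> carrier_mat n n"
    unfolding A_def B_def using L by (auto intro: char_poly_matrix_closed)
  have AB: "B $$ (i, j) = A $$ (p i, p j)" if "i < n" "j < n" for i j
    using that L permutes_inj[OF pn]
    by (auto simp: A_def B_def char_poly_matrix_def laplacian_matrix_def degree_matrix_def
        adjacency_matrix_def len p_less ws_nth n_def[symmetric] inj_eq)
  define C where "C = mat n n (\<lambda>(i, j). A $$ (p i, j))"
  have C: "C \<in> carrier_mat n n"
    by (simp add: C_def)
  have "transpose_mat B = mat n n (\<lambda>(i, j). transpose_mat C $$ (p i, j))"
    using B by (intro eq_matI) (auto simp: AB C_def p_less)
  then have "det (transpose_mat B) = signof p * det (transpose_mat C)"
    using det_permute_rows[of "transpose_mat C" n p] C pn by simp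
  then have "det B = signof p * det C"
    using det_transpose[OF B] det_transpose[OF C] by simp
  also have "det C = signof p * det A"
    unfolding C_def by (rule det_permute_rows[OF A pn])
  finally have "det B = det A"
    by (simp add: sign_def)
  then show ?thesis
    by (simp add: char_poly_def A_def B_def)
qed

lemma laplacian_eigenvalues_eq:
  assumes "distinct vs" "set vs = pverts G"
  shows "laplacian_eigenvalues G = proots (char_poly (laplacian_matrix G vs))"
proof -
  have "\<exists>vs. distinct vs \<and> set vs = pverts G"
    using assms by blast
  then have "distinct (vertex_enumeration G) \<and> set (vertex_enumeration G) = pverts G"
    unfolding vertex_enumeration_def by (rule someI_ex)
  with assms show ?thesis
    unfolding laplacian_eigenvalues_def by (metis char_poly_laplacian_matrix_cong)
qed

end

(*
  Write c = 2 - 2/n for the average degree of T. As the Laplacian eigenvalues of a graph have mean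
  equal to the average degree, LE(T) is twice the sum of (mu - c)^+ over the eigenvalues mu of T, and
  by Ky Fan's principle that sum dominates every sum of (Rayleigh quotient - c) over an orthogonal
  family. For the disjoint union of T1 and T2 one takes the eigenvectors of T1 with eigenvalue at
  least the average degree of T1, together with one or two explicit vectors on T2, which is a star or
  a double star.

  Joining u and v adds the rank one term z z^t with z = e_u - e_v. Let s be the squared length of the
  projection of z to the eigenspaces of the union with eigenvalue at least c. Using these eigenspaces
  gains s; adjoining the component q of z orthogonal to them gains 2/n plus the Rayleigh quotient of
  q, which the first two moments of the spectral measure of z bound below by 1 - sqrt(s/(2 - s)).
  One of the two gains is at least 0.45 + 1/n.

  The loss from replacing the average degree of T1 by c is proportional to the number of eigenvalues
  of T1 above the average; it is controlled because the remaining ones, each at most 2 - 2/n1 below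
  the average, have total deficiency LE(T1)/2 >= 1 + 2 n1/pi.
*)

theory Submission
  imports Defs "Jordan_Normal_Form.Schur_Decomposition"
begin

section \<open>Orthogonal diagonalization of real symmetric matrices\<close>

text \<open>The number 4/pi is the mean of |2 cos| over a period: the path has Laplacian eigenvalues
  2 - 2 cos (pi k / n), and a Dirichlet kernel sum yields LE(P_n) <= 4n/pi + 2, which settles the
  comparison with the path. Half of this target splits into 1 + 2 n1/pi, which T1 pays by
  hypothesis, and 2 n2/pi, about 0.637 n2, which T2 and the new edge have to pay. The obstacle is
  that the trial vectors on T2 may not earn this share. For a double star on six vertices they give
  7.51 - 2c = 3.51 + 4/n, while 3.82 is needed. Hence it is not enough that eigenvalues do not
  decrease when an edge is added; the edge must bring a definite gain. The two candidates s and 1 -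
  sqrt(s/(2 - s)) run in opposite directions and meet near s = 0.456, whence the constant 0.45. Of
  the extra 2/n in the second gain, one half goes into the final bound and the other half relaxes
  what is asked of the Rayleigh quotient of q to 0.45 - 1/n. Only lower bounds for sums of Rayleigh
  quotients enter, so the spectra of T2 and T never have to be located.\<close>

lemma scalar_prod_self_pos:
  fixes v :: "real vec"
  assumes "v \<in> carrier_vec n" "v \<noteq> 0\<^sub>v n"
  shows "v \<bullet> v > 0"
proof -
  have "v \<bullet> v \<noteq> 0"
    using conjugate_square_eq_0_vec[OF assms(1)] assms(2) by simp
  moreover have "v \<bullet> v \<ge> 0"
    by (auto simp: scalar_prod_def intro!: sum_nonneg)
  ultimately show ?thesis by simp
qed

text \<open>Gram-Schmidt keeps the first vector of the basis it is given. Starting from a basis that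
  begins with \<open>v\<close>, only the length of \<open>v\<close> is changed by the final
  normalization.\<close>

lemma orthogonal_mat_extension:
  fixes v :: "real vec"
  assumes v: "v \<in> carrier_vec n" and v0: "v \<noteq> 0\<^sub>v n" and n: "n \<noteq> 0"
  obtains W c where "W \<in> carrier_mat n n" "transpose_mat W * W = 1\<^sub>m n" "col W 0 = c \<cdot>\<^sub>v v"
proof -
  interpret cof_vec_space n "TYPE(real)" .
  define b where "b = basis_completion v"
  define ws where "ws = gram_schmidt n b"
  from basis_completion[OF v v0, folded b_def]
  have dist_b: "distinct b" and indep: "\<not> lin_dep (set b)" and b: "set b \<subseteq> carrier_vec n"
    and hdb: "hd b = v" and len_b: "length b = n"
    by auto
  from hdb len_b n obtain vs where bv: "b = v # vs" by (cases b) auto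
  from gram_schmidt_result[OF b dist_b indep refl, folded ws_def]
  have ws: "set ws \<subseteq> carrier_vec n" "corthogonal ws" "length ws = n"
    by (auto simp: len_b)
  from gram_schmidt_hd[OF v, of vs, folded bv] have hdws: "hd ws = v"
    unfolding ws_def .
  then have ws0: "ws ! 0 = v"
    using ws(3) n by (cases ws) auto
  have wsc: "ws ! i \<in> carrier_vec n" if "i < n" for i
    using ws(1,3) that by auto
  have orth: "ws ! i \<bullet> ws ! j = 0 \<longleftrightarrow> i \<noteq> j" if "i < n" "j < n" for i j
    using corthogonalD[OF ws(2)] ws(3) that by simp
  have pos: "ws ! i \<bullet> ws ! i > 0" if "i < n" for i
    using scalar_prod_self_pos[OF wsc[OF that]] orth[OF that that] that by fastforce
  define f where "f w = (1 / sqrt (w \<bullet> w)) \<cdot>\<^sub>v w" for w :: "real vec"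
  define W where "W = mat_of_cols n (map f ws)"
  have W: "W \<in> carrier_mat n n"
    using mat_of_cols_carrier(1)[of n "map f ws"] ws(3) unfolding W_def by simp
  have colW: "col W i = f (ws ! i)" if "i < n" for i
    unfolding W_def using that ws(3) wsc[OF that] by (subst col_mat_of_cols) (auto simp: f_def)
  have "transpose_mat W * W = 1\<^sub>m n"
  proof (rule eq_matI)
    fix i j assume ij: "i < dim_row (1\<^sub>m n :: real mat)" "j < dim_col (1\<^sub>m n :: real mat)"
    have "(transpose_mat W * W) $$ (i, j) = f (ws ! i) \<bullet> f (ws ! j)"
      using W ij by (simp add: colW)
    also have "\<dots> = (1 / sqrt (ws ! i \<bullet> ws ! i)) * ((1 / sqrt (ws ! j \<bullet> ws ! j)) * (ws ! i \<bullet> ws ! j))"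
      unfolding f_def using ij wsc[of i] wsc[of j] by simp
    also have "\<dots> = 1\<^sub>m n $$ (i, j)"
    proof (cases "i = j")
      case True
      then show ?thesis using ij pos[of i] by (simp add: field_simps)
    next
      case False
      then show ?thesis using ij orth[of i j] by simp
    qed
    finally show "(transpose_mat W * W) $$ (i, j) = 1\<^sub>m n $$ (i, j)" .
  qed (use W in auto)
  moreover have "col W 0 = (1 / sqrt (v \<bullet> v)) \<cdot>\<^sub>v v"
    using colW[of 0] n ws0 by (simp add: f_def)
  ultimately show ?thesis using that W by blast
qed

text \<open>Over the complex numbers an eigenpair exists. Evaluating the Hermitian form of
  \<open>C\<close> at \<open>w\<close> by rows and by columns gives
  \<open>a * N = cnj a * N\<close>, so \<open>a\<close> is real. The vector \<open>w\<close> need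
  not be real, so a real eigenvector is obtained from the real root of \<open>char_poly A\<close>
  instead.\<close>

lemma symmetric_mat_eigenvector:
  fixes A :: "real mat"
  assumes A: "A \<in> carrier_mat n n" and sym: "transpose_mat A = A" and n: "n \<noteq> 0"
  obtains v e where "v \<in> carrier_vec n" "v \<noteq> 0\<^sub>v n" "A *\<^sub>v v = e \<cdot>\<^sub>v v"
proof -
  define C where "C = map_mat complex_of_real A"
  have C: "C \<in> carrier_mat n n" using A by (simp add: C_def)
  obtain as where as: "char_poly C = (\<Prod>a\<leftarrow>as. [:- a, 1:])" "length as = n"
    using char_poly_factorized[OF C] by blast
  with n obtain a where "poly (char_poly C) a = 0"
    by (cases as) auto
  then have "eigenvalue C a" using eigenvalue_root_char_poly[OF C] by simp
  then obtain w where w: "w \<in> carrier_vec n" "w \<noteq> 0\<^sub>v n" "C *\<^sub>v w = a \<cdot>\<^sub>v w"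
    unfolding eigenvalue_def eigenvector_def using C by auto
  have Csym: "C $$ (i, j) = C $$ (j, i)" "cnj (C $$ (i, j)) = C $$ (i, j)" if "i < n" "j < n" for i j
  proof -
    have "A $$ (i, j) = transpose_mat A $$ (i, j)" using sym by simp
    also have "\<dots> = A $$ (j, i)" using A that by simp
    finally show "C $$ (i, j) = C $$ (j, i)" "cnj (C $$ (i, j)) = C $$ (i, j)"
      using that A by (auto simp: C_def)
  qed
  have ev: "(\<Sum>j<n. C $$ (i, j) * w $ j) = a * w $ i" if "i < n" for i
  proof -
    have "(\<Sum>j<n. C $$ (i, j) * w $ j) = (C *\<^sub>v w) $ i"
      using C w(1) that by (simp add: scalar_prod_def atLeast0LessThan)
    also have "\<dots> = a * w $ i" using w(1) that by (simp add: w(3))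
    finally show ?thesis .
  qed
  define N where "N = (\<Sum>i<n. w $ i * cnj (w $ i))"
  have "N = complex_of_real (\<Sum>i<n. (cmod (w $ i))\<^sup>2)"
    unfolding N_def of_real_sum complex_norm_square ..
  moreover have "(\<Sum>i<n. (cmod (w $ i))\<^sup>2) \<noteq> 0"
  proof
    assume "(\<Sum>i<n. (cmod (w $ i))\<^sup>2) = 0"
    then have "w $ i = 0" if "i < n" for i
      using that by (subst (asm) sum_nonneg_eq_0_iff) auto
    then have "w = 0\<^sub>v n" using w(1) by (intro eq_vecI) auto
    with w show False by simp
  qed
  ultimately have N: "N \<noteq> 0" by (simp del: of_real_sum of_real_power)
  have "a * N = (\<Sum>i<n. (\<Sum>j<n. C $$ (i, j) * w $ j) * cnj (w $ i))"
    by (simp add: N_def sum_distrib_left ev mult.assoc)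
  also have "\<dots> = (\<Sum>i<n. \<Sum>j<n. C $$ (i, j) * w $ j * cnj (w $ i))"
    by (simp add: sum_distrib_right)
  also have "\<dots> = (\<Sum>j<n. \<Sum>i<n. C $$ (i, j) * w $ j * cnj (w $ i))"
    by (rule sum.swap)
  also have "\<dots> = (\<Sum>j<n. w $ j * cnj (\<Sum>i<n. C $$ (j, i) * w $ i))"
    by (auto simp: sum_distrib_left Csym intro!: sum.cong) 
  also have "\<dots> = (\<Sum>j<n. w $ j * cnj (a * w $ j))"
    by (intro sum.cong refl) (simp only: ev lessThan_iff)
  also have "\<dots> = cnj a * N"
    by (simp add: N_def sum_distrib_left algebra_simps)
  finally have "a = cnj a" using N by simp
  then have "a = complex_of_real (Re a)"
    by (metis Reals_cnj_iff of_real_Re)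
  then obtain e where a: "a = complex_of_real e" by blast
  have "char_poly C = map_poly complex_of_real (char_poly A)"
    unfolding C_def by (rule of_real_hom.char_poly_hom[OF A])
  then have "poly (char_poly A) e = 0"
    using \<open>poly (char_poly C) a = 0\<close> by (simp add: a)
  then have "eigenvalue A e" using eigenvalue_root_char_poly[OF A] by simp
  then show ?thesis using that A unfolding eigenvalue_def eigenvector_def by auto
qed

text \<open>Deflation: in an orthonormal basis that begins with an eigenvector, the first column of
  the matrix is \<open>e\<close> times a unit vector, and by symmetry so is the first row. The
  remaining block \<open>C\<close> is again symmetric. The equation
  \<open>A * U = U * mat_diag n d\<close> says that the columns of \<open>U\<close> are
  eigenvectors.\<close>

theorem symmetric_mat_diagonalization:
  fixes A :: "real mat"
  assumes "A \<in> carrier_mat n n" "transpose_mat A = A"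
  shows "\<exists>U d. U \<in> carrier_mat n n \<and> transpose_mat U * U = 1\<^sub>m n \<and>
    A * U = U * mat_diag n d"
  using assms
proof (induction n arbitrary: A)
  case 0
  then have "A * 1\<^sub>m 0 = 1\<^sub>m 0 * mat_diag 0 (\<lambda>_. 0)"
    by (intro eq_matI) (auto simp: mat_diag_def)
  then have "1\<^sub>m 0 \<in> carrier_mat 0 0 \<and> transpose_mat (1\<^sub>m 0) * 1\<^sub>m 0 = (1\<^sub>m 0 :: real mat) \<and>
      A * 1\<^sub>m 0 = 1\<^sub>m 0 * mat_diag 0 (\<lambda>_. 0)"
    by simp
  then show ?case by blast
next
  case (Suc m)
  let ?n = "Suc m"
  note A = Suc.prems(1) and sym = Suc.prems(2)
  obtain v e where v: "v \<in> carrier_vec ?n" "v \<noteq> 0\<^sub>v ?n" "A *\<^sub>v v = e \<cdot>\<^sub>v v"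
    using symmetric_mat_eigenvector[OF A sym] by blast
  obtain W c where W: "W \<in> carrier_mat ?n ?n" "transpose_mat W * W = 1\<^sub>m ?n" "col W 0 = c \<cdot>\<^sub>v v"
    using orthogonal_mat_extension[OF v(1,2)] by blast
  note Wt = transpose_carrier_mat[THEN iffD2, OF W(1)]
  have WW: "W * transpose_mat W = 1\<^sub>m ?n"
    using mat_mult_left_right_inverse[OF Wt W(1,2)] .
  define B where "B = transpose_mat W * (A * W)"
  have B: "B \<in> carrier_mat ?n ?n" unfolding B_def using W A by simp
  have AWc: "A * W \<in> carrier_mat ?n ?n" using A W(1) by simp
  have AW: "A * W = W * B"
    unfolding B_def assoc_mult_mat[OF W(1) Wt AWc, symmetric] WW
    by (rule left_mult_one_mat[OF AWc, symmetric])
  have Bsym: "transpose_mat B = B"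
    unfolding B_def transpose_mult[OF Wt AWc] transpose_mult[OF A W(1)] sym
    by (simp add: assoc_mult_mat[OF Wt A W(1)])
  have AW0: "col (A * W) 0 = e \<cdot>\<^sub>v col W 0"
    unfolding col_mult2[OF A W(1) zero_less_Suc] W(3) mult_mat_vec[OF A v(1)] v(3)
    by (simp add: smult_smult_assoc mult.commute)
  have B0: "B $$ (i, 0) = (if i = 0 then e else 0)" if "i < ?n" for i
  proof -
    have "B $$ (i, 0) = col W i \<bullet> col (A * W) 0"
      unfolding B_def using W(1) A that by simp
    also have "\<dots> = e * (col W i \<bullet> col W 0)"
      unfolding AW0 using W(1) that by simp
    also have "col W i \<bullet> col W 0 = (transpose_mat W * W) $$ (i, 0)"
      using W(1) that by simp
    finally show ?thesis using W(2) that by simp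
  qed
  have B0': "B $$ (0, i) = (if i = 0 then e else 0)" if "i < ?n" for i
  proof -
    have "B $$ (0, i) = transpose_mat B $$ (i, 0)" using that B by simp
    then show ?thesis using B0[OF that] Bsym by simp
  qed
  define C where "C = mat m m (\<lambda>(i, j). B $$ (Suc i, Suc j))"
  have C: "C \<in> carrier_mat m m" by (simp add: C_def)
  have "transpose_mat C = C"
  proof (rule eq_matI)
    fix i j assume "i < dim_row C" "j < dim_col C"
    then have ij: "i < m" "j < m" by (auto simp: C_def)
    have "B $$ (Suc j, Suc i) = transpose_mat B $$ (Suc i, Suc j)" using B ij by simp
    then show "transpose_mat C $$ (i, j) = C $$ (i, j)"
      using ij Bsym by (simp add: C_def)
  qed (auto simp: C_def)
  then obtain X d where X: "X \<in> carrier_mat m m" "transpose_mat X * X = 1\<^sub>m m"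
    "C * X = X * mat_diag m d"
    using Suc.IH[OF C] by blast
  define E where "E = mat 1 1 (\<lambda>_. e)"
  let ?z = "0\<^sub>m 1 m :: real mat" and ?z' = "0\<^sub>m m 1 :: real mat"
  have E: "E \<in> carrier_mat 1 1" by (simp add: E_def)
  have Bblock: "B = four_block_mat E ?z ?z' C"
    using B by (intro eq_matI) (auto simp: E_def C_def B0 B0' less_Suc_eq_0_disj)
  define Y where "Y = four_block_mat (1\<^sub>m 1) ?z ?z' X"
  have Y: "Y \<in> carrier_mat ?n ?n"
    unfolding Y_def using four_block_carrier_mat[OF one_carrier_mat[of 1] X(1)] by simp
  have D: "mat_diag ?n (case_nat e d) = four_block_mat E ?z ?z' (mat_diag m d)"
    by (intro eq_matI) (auto simp: E_def mat_diag_def less_Suc_eq_0_disj)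
  have Dm: "mat_diag m d \<in> carrier_mat m m" by (simp add: mat_diag_def)
  have YtY: "transpose_mat Y * Y = 1\<^sub>m ?n"
  proof -
    have Yt: "transpose_mat Y = four_block_mat (1\<^sub>m 1) ?z ?z' (transpose_mat X)"
      unfolding Y_def
      using transpose_four_block_mat[OF one_carrier_mat[of 1] zero_carrier_mat[of 1 m] zero_carrier_mat[of m 1] X(1)] by simp
    have "transpose_mat Y * Y = four_block_mat (1\<^sub>m 1) ?z ?z' (1\<^sub>m m)"
      unfolding Yt unfolding Y_def
      using mult_four_block_mat[OF one_carrier_mat[of 1] zero_carrier_mat[of 1 m] zero_carrier_mat[of m 1]
          transpose_carrier_mat[THEN iffD2, OF X(1)] one_carrier_mat[of 1] zero_carrier_mat[of 1 m] zero_carrier_mat[of m 1] X(1)] X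
      by simp
    then show ?thesis using four_block_one_mat[of 1 m] by simp
  qed
  have BY: "B * Y = Y * mat_diag ?n (case_nat e d)"
    unfolding D Bblock Y_def
    using mult_four_block_mat[OF E zero_carrier_mat[of 1 m] zero_carrier_mat[of m 1] C one_carrier_mat[of 1] zero_carrier_mat[of 1 m] zero_carrier_mat[of m 1] X(1)]
     mult_four_block_mat[OF one_carrier_mat[of 1] zero_carrier_mat[of 1 m] zero_carrier_mat[of m 1] X(1) E zero_carrier_mat[of 1 m] zero_carrier_mat[of m 1] Dm]
     X C E Dm
    by simp
  have Dn: "mat_diag ?n (case_nat e d) \<in> carrier_mat ?n ?n" by (simp add: mat_diag_def)
  show ?case
  proof (intro exI conjI)
    show "W * Y \<in> carrier_mat ?n ?n" using W(1) Y by simp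
    have "transpose_mat (W * Y) * (W * Y) = transpose_mat Y * (transpose_mat W * (W * Y))"
      using W(1) Y by (simp add: transpose_mult[OF W(1) Y] assoc_mult_mat[of _ ?n ?n _ ?n _ ?n])
    also have "transpose_mat W * (W * Y) = Y"
      unfolding assoc_mult_mat[OF Wt W(1) Y, symmetric] W(2) using Y by simp
    finally show "transpose_mat (W * Y) * (W * Y) = 1\<^sub>m ?n" using YtY by simp
    show "A * (W * Y) = W * Y * mat_diag ?n (case_nat e d)"
    proof -
      have "A * (W * Y) = (A * W) * Y" using A W(1) Y by simp
      also have "\<dots> = W * (B * Y)" using AW W(1) B Y by simp
      also have "\<dots> = W * Y * mat_diag ?n (case_nat e d)" unfolding BY by (rule assoc_mult_mat[OF W(1) Y Dn, symmetric])
      finally show ?thesis .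
    qed
  qed
qed

section \<open>Spectral decompositions and Ky Fan's inequality\<close>

text \<open>Vectors are functions on vertices instead of indexed tuples, so vectors of a subgraph,
  of a disjoint union and of the joined graph can be compared without aligning enumerations.\<close>

definition dot :: "'a set \<Rightarrow> ('a \<Rightarrow> real) \<Rightarrow> ('a \<Rightarrow> real) \<Rightarrow> real" where
  "dot V x y = (\<Sum>v\<in>V. x v * y v)"

lemma dot_commute: "dot V x y = dot V y x"
  by (simp add: dot_def mult.commute)

lemma dot_scale_left: "dot V (\<lambda>v. c * x v) y = c * dot V x y"
  by (simp add: dot_def sum_distrib_left mult.assoc)

lemma dot_diff_left: "dot V (\<lambda>v. x v - x' v) y = dot V x y - dot V x' y"
  by (simp add: dot_def sum_subtractf algebra_simps)

lemma dot_sum_left: "dot V (\<lambda>v. \<Sum>i\<in>I. x i v) y = (\<Sum>i\<in>I. dot V (x i) y)"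
  unfolding dot_def by (subst sum.swap) (simp add: sum_distrib_right)

lemma dot_scale_right: "dot V y (\<lambda>v. c * x v) = c * dot V y x"
  by (simp add: dot_commute[of V y] dot_scale_left)

lemma dot_diff_right: "dot V y (\<lambda>v. x v - x' v) = dot V y x - dot V y x'"
  by (simp add: dot_commute[of V y] dot_diff_left)

lemma dot_sum_right: "dot V y (\<lambda>v. \<Sum>i\<in>I. x i v) = (\<Sum>i\<in>I. dot V y (x i))"
  by (simp add: dot_commute[of V y] dot_sum_left)

lemma dot_self_nonneg: "dot V x x \<ge> 0"
  by (simp add: dot_def sum_nonneg)

lemma dot_cong: "(\<And>v. v \<in> V \<Longrightarrow> x v = x' v) \<Longrightarrow> (\<And>v. v \<in> V \<Longrightarrow> y v = y' v) \<Longrightarrow> dot V x y = dot V x' y'"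
  by (simp add: dot_def cong: sum.cong)

text \<open>The residual of \<open>y\<close> after projection to the span has nonnegative squared
  length. The vectors are not normalized, because the explicit trial vectors used later are
  not.\<close>

lemma bessel_inequality:
  assumes I: "finite I"
    and orth: "\<And>i j. i \<in> I \<Longrightarrow> j \<in> I \<Longrightarrow> i \<noteq> j \<Longrightarrow> dot V (f i) (f j) = 0"
    and pos: "\<And>i. i \<in> I \<Longrightarrow> dot V (f i) (f i) > 0"
  shows "(\<Sum>i\<in>I. (dot V (f i) y)\<^sup>2 / dot V (f i) (f i)) \<le> dot V y y"
proof -
  define c where "c i = dot V (f i) y / dot V (f i) (f i)" for i
  define p where "p v = (\<Sum>i\<in>I. c i * f i v)" for v
  define S where "S = (\<Sum>i\<in>I. (dot V (f i) y)\<^sup>2 / dot V (f i) (f i))"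
  have py: "dot V p y = S"
    unfolding p_def dot_sum_left dot_scale_left S_def
    by (intro sum.cong refl) (simp add: c_def power2_eq_square)
  have pf: "dot V p (f j) = dot V (f j) y" if j: "j \<in> I" for j
  proof -
    have "dot V p (f j) = (\<Sum>i\<in>I. c i * dot V (f i) (f j))"
      unfolding p_def dot_sum_left by (simp add: dot_scale_left)
    also have "\<dots> = (\<Sum>i\<in>I. if i = j then c j * dot V (f j) (f j) else 0)"
      using orth j by (intro sum.cong) auto
    also have "\<dots> = dot V (f j) y"
      using I j pos[OF j] by (simp add: c_def)
    finally show ?thesis .
  qed
  have "dot V p p = dot V p (\<lambda>v. \<Sum>i\<in>I. c i * f i v)"
    by (rule dot_cong) (simp_all add: p_def)
  also have "\<dots> = (\<Sum>i\<in>I. c i * dot V p (f i))"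
    unfolding dot_sum_right dot_scale_right ..
  also have "\<dots> = S"
    unfolding S_def by (intro sum.cong refl) (simp add: pf c_def power2_eq_square)
  finally have pp: "dot V p p = S" .
  have "0 \<le> dot V (\<lambda>v. y v - p v) (\<lambda>v. y v - p v)"
    by (rule dot_self_nonneg)
  also have "\<dots> = dot V y y - 2 * dot V p y + dot V p p"
    unfolding dot_diff_left dot_diff_right dot_commute[of V y p] by simp
  finally show ?thesis unfolding py pp S_def[symmetric] by simp
qed

text \<open>Both relations of an orthogonal matrix are demanded: \<open>orthonormal\<close> for its
  columns and \<open>complete\<close> for its rows. Summing squares in two ways shows that
  \<open>n\<close> is then the cardinality of \<open>V\<close>.\<close>

locale spectral_decomposition =
  fixes V :: "'a set" and L :: "('a \<Rightarrow> real) \<Rightarrow> 'a \<Rightarrow> real"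
    and b :: "nat \<Rightarrow> 'a \<Rightarrow> real" and \<mu> :: "nat \<Rightarrow> real" and n :: nat
  assumes finite_V: "finite V"
    and self_adjoint: "dot V (L x) y = dot V x (L y)"
    and orthonormal: "i < n \<Longrightarrow> j < n \<Longrightarrow> dot V (b i) (b j) = (if i = j then 1 else 0)"
    and complete: "v \<in> V \<Longrightarrow> w \<in> V \<Longrightarrow> (\<Sum>k<n. b k v * b k w) = (if v = w then 1 else 0)"
    and eigen: "k < n \<Longrightarrow> v \<in> V \<Longrightarrow> L (b k) v = \<mu> k * b k v"
begin

lemma expansion:
  assumes "v \<in> V"
  shows "(\<Sum>k<n. dot V x (b k) * b k v) = x v"
proof -
  have "(\<Sum>k<n. dot V x (b k) * b k v) = (\<Sum>k<n. \<Sum>w\<in>V. x w * b k w * b k v)"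
    by (simp add: dot_def sum_distrib_right)
  also have "\<dots> = (\<Sum>w\<in>V. x w * (\<Sum>k<n. b k w * b k v))"
    by (subst sum.swap) (simp add: sum_distrib_left mult.assoc)
  also have "\<dots> = (\<Sum>w\<in>V. if w = v then x w else 0)"
    using assms by (intro sum.cong refl) (simp add: complete)
  also have "\<dots> = x v"
    using assms finite_V by simp
  finally show ?thesis .
qed

lemma parseval: "(\<Sum>k<n. dot V x (b k) * dot V y (b k)) = dot V x y"
proof -
  have "dot V x y = dot V (\<lambda>v. \<Sum>k<n. dot V x (b k) * b k v) y"
    by (rule dot_cong) (simp_all add: expansion)
  also have "\<dots> = (\<Sum>k<n. dot V x (b k) * dot V y (b k))"
    unfolding dot_sum_left dot_scale_left dot_commute[of V y] ..
  finally show ?thesis by simp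
qed

lemma dot_L_eigenvector:
  assumes "k < n"
  shows "dot V (L x) (b k) = \<mu> k * dot V x (b k)"
proof -
  have "dot V (L x) (b k) = dot V (L (b k)) x"
    using self_adjoint[of x "b k"] dot_commute[of V x "L (b k)"] by simp
  also have "\<dots> = dot V (\<lambda>v. \<mu> k * b k v) x"
    using assms by (intro dot_cong) (auto simp: eigen)
  finally show ?thesis by (simp add: dot_scale_left dot_commute)
qed

lemma dot_L_self: "dot V (L x) x = (\<Sum>k<n. \<mu> k * (dot V x (b k))\<^sup>2)"
  unfolding parseval[of "L x" x, symmetric]
  by (intro sum.cong refl) (simp add: dot_L_eigenvector power2_eq_square)

lemma dot_L_L: "dot V (L x) (L x) = (\<Sum>k<n. (\<mu> k)\<^sup>2 * (dot V x (b k))\<^sup>2)"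
  unfolding parseval[of "L x" "L x", symmetric]
  by (intro sum.cong refl) (simp add: dot_L_eigenvector power2_eq_square)

lemma dot_self: "dot V x x = (\<Sum>k<n. (dot V x (b k))\<^sup>2)"
  unfolding parseval[of x x, symmetric] by (simp add: power2_eq_square)

text \<open>Let \<open>t k\<close> be the squared length of the projection of \<open>b k\<close> to
  the span of the family. The left side is the sum of \<open>(\<mu> k - c) * t k\<close>, and by
  Bessel \<open>t k\<close> lies between 0 and 1, so each term is at most the positive part. The
  family may have any size and the eigenvalues need no ordering.\<close>

lemma ky_fan_inequality:
  assumes I: "finite I"
    and orth: "\<And>i j. i \<in> I \<Longrightarrow> j \<in> I \<Longrightarrow> i \<noteq> j \<Longrightarrow> dot V (f i) (f j) = 0"
    and pos: "\<And>i. i \<in> I \<Longrightarrow> dot V (f i) (f i) > 0"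
  shows "(\<Sum>i\<in>I. dot V (L (f i)) (f i) / dot V (f i) (f i) - c) \<le> (\<Sum>k<n. max 0 (\<mu> k - c))"
proof -
  define t where "t k = (\<Sum>i\<in>I. (dot V (f i) (b k))\<^sup>2 / dot V (f i) (f i))" for k
  have t0: "0 \<le> t k" for k
    unfolding t_def using pos by (intro sum_nonneg divide_nonneg_nonneg) (auto intro: less_imp_le)
  have t1: "t k \<le> 1" if "k < n" for k
    unfolding t_def using bessel_inequality[OF I orth pos, where y = "b k"] orthonormal[OF that that] by simp
  have "(\<Sum>i\<in>I. dot V (L (f i)) (f i) / dot V (f i) (f i) - c) =
      (\<Sum>i\<in>I. \<Sum>k<n. (\<mu> k - c) * ((dot V (f i) (b k))\<^sup>2 / dot V (f i) (f i)))"
  proof (intro sum.cong refl)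
    fix i assume i: "i \<in> I"
    have "dot V (L (f i)) (f i) / dot V (f i) (f i) - c =
        (dot V (L (f i)) (f i) - c * dot V (f i) (f i)) / dot V (f i) (f i)"
      using pos[OF i] by (simp add: field_simps)
    also have "dot V (L (f i)) (f i) - c * dot V (f i) (f i) = (\<Sum>k<n. (\<mu> k - c) * (dot V (f i) (b k))\<^sup>2)"
      unfolding dot_L_self dot_self[of "f i"] by (simp add: sum_distrib_left sum_subtractf algebra_simps)
    finally show "dot V (L (f i)) (f i) / dot V (f i) (f i) - c =
        (\<Sum>k<n. (\<mu> k - c) * ((dot V (f i) (b k))\<^sup>2 / dot V (f i) (f i)))"
      by (simp add: sum_divide_distrib)
  qed
  also have "\<dots> = (\<Sum>k<n. (\<mu> k - c) * t k)"
    unfolding t_def by (subst sum.swap) (simp add: sum_distrib_left)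
  also have "\<dots> \<le> (\<Sum>k<n. max 0 (\<mu> k - c))"
  proof (rule sum_mono)
    fix k assume "k \<in> {..<n}"
    then have "t k \<le> 1" using t1 by simp
    show "(\<mu> k - c) * t k \<le> max 0 (\<mu> k - c)"
    proof (cases "\<mu> k - c \<ge> 0")
      case True
      then show ?thesis using \<open>t k \<le> 1\<close> mult_left_le[of "t k" "\<mu> k - c"] by simp
    next
      case False
      then show ?thesis using t0[of k] by (simp add: mult_nonpos_nonneg)
    qed
  qed
  finally show ?thesis .
qed

end


section \<open>One added edge as a rank one perturbation\<close>

lemma weighted_Cauchy_Schwarz:
  fixes w g :: "'b \<Rightarrow> real"
  assumes I: "finite I" and w: "\<And>i. i \<in> I \<Longrightarrow> 0 \<le> w i"
  shows "(\<Sum>i\<in>I. g i * w i)\<^sup>2 \<le> (\<Sum>i\<in>I. w i) * (\<Sum>i\<in>I. (g i)\<^sup>2 * w i)"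
proof -
  define S G T where "S = (\<Sum>i\<in>I. w i)" and "G = (\<Sum>i\<in>I. g i * w i)" and "T = (\<Sum>i\<in>I. (g i)\<^sup>2 * w i)"
  \<comment> \<open>This is the variance of \<open>g\<close> cleared of denominators, since the
    total mass \<open>S\<close> may be zero.\<close>
  have "0 \<le> (\<Sum>i\<in>I. (S * g i - G)\<^sup>2 * w i)"
    using w by (intro sum_nonneg) simp
  also have "\<dots> = (\<Sum>i\<in>I. S\<^sup>2 * ((g i)\<^sup>2 * w i) - 2 * S * G * (g i * w i) + G\<^sup>2 * w i)"
    by (intro sum.cong refl) (simp add: power2_eq_square algebra_simps)
  also have "\<dots> = S\<^sup>2 * T - 2 * S * G * G + G\<^sup>2 * S"
    by (simp add: S_def G_def T_def sum.distrib sum_subtractf sum_distrib_left)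
  also have "\<dots> = S * (S * T - G\<^sup>2)"
    by (simp add: power2_eq_square algebra_simps)
  finally have *: "0 \<le> S * (S * T - G\<^sup>2)" .
  have "S \<ge> 0" using w unfolding S_def by (intro sum_nonneg)
  show ?thesis unfolding S_def[symmetric] G_def[symmetric] T_def[symmetric]
  proof (cases "S = 0")
    case True
    then have "w i = 0" if "i \<in> I" for i
      using that w I unfolding S_def by (simp add: sum_nonneg_eq_0_iff)
    then have "G = 0" by (simp add: G_def)
    with True show "G\<^sup>2 \<le> S * T" by simp
  next
    case False
    with \<open>S \<ge> 0\<close> * show "G\<^sup>2 \<le> S * T" by (simp add: zero_le_mult_iff)
  qed
qed

text \<open>
  With respect to the weights \<open>w k / 2\<close>, \<open>\<mu>\<close> has mean \<open>m = (a + b) / 2\<close>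
  and, since \<open>a, b \<ge> 1\<close>, variance at most \<open>m\<^sup>2\<close>. A set \<open>K\<close> of small mass
  therefore cannot carry much of the mean.
\<close>

lemma rayleigh_bound_from_moments:
  fixes w \<mu> :: "nat \<Rightarrow> real" and a b x s :: real
  assumes w: "\<And>k. 0 \<le> w k"
    and K: "K \<subseteq> {..<n}"
    and m0: "(\<Sum>k<n. w k) = 2"
    and m1: "(\<Sum>k<n. \<mu> k * w k) = a + b"
    and m2: "(\<Sum>k<n. (\<mu> k)\<^sup>2 * w k) = a\<^sup>2 + a + b\<^sup>2 + b"
    and ab: "1 \<le> a" "1 \<le> b"
    and x: "0 \<le> x" "x \<le> 6 / 100"
    and s: "s = (\<Sum>k\<in>K. w k)" "s < 45 / 100 + x"
  shows "(45 / 100 - x) * (2 - s) \<le> (\<Sum>k\<in>{..<n} - K. \<mu> k * w k)"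
proof -
  define m where "m = (a + b) / 2"
  have ab2: "a + b - m * 2 = 0" by (simp add: m_def field_simps)
  have m: "1 \<le> m" using ab by (simp add: m_def)
  have split: "(\<Sum>k\<in>K. h k) + (\<Sum>k\<in>{..<n} - K. h k) = (\<Sum>k<n. h k)" for h :: "nat \<Rightarrow> real"
    using sum.subset_diff[OF K, of h] by simp
  have s': "(\<Sum>k\<in>{..<n} - K. w k) = 2 - s"
    using split[of w] m0 s(1) by simp
  have s0: "0 \<le> s" unfolding s(1) by (intro sum_nonneg w)
  have s2: "0 < 2 - s" using s(2) x(2) by simp
  define \<delta> where "\<delta> = (\<Sum>k\<in>K. (\<mu> k - m) * w k)"
  define P where "P = (\<Sum>k\<in>K. (\<mu> k - m)\<^sup>2 * w k)"
  define Q where "Q = (\<Sum>k\<in>{..<n} - K. (\<mu> k - m)\<^sup>2 * w k)"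
  have "(\<Sum>k<n. (\<mu> k - m) * w k) = a + b - m * 2"
    unfolding m1[symmetric] m0[symmetric]
    by (simp add: sum_distrib_left sum_subtractf algebra_simps)
  then have \<delta>': "(\<Sum>k\<in>{..<n} - K. (\<mu> k - m) * w k) = - \<delta>"
    using split[of "\<lambda>k. (\<mu> k - m) * w k"] ab2 unfolding \<delta>_def by linarith
  have "(\<Sum>k<n. (\<mu> k - m)\<^sup>2 * w k) = (\<Sum>k<n. (\<mu> k)\<^sup>2 * w k) - 2 * m * (\<Sum>k<n. \<mu> k * w k) + m\<^sup>2 * (\<Sum>k<n. w k)"
    by (simp add: sum_distrib_left sum_subtractf sum.distrib power2_eq_square algebra_simps)
  then have "P + Q = a\<^sup>2 + a + b\<^sup>2 + b - 2 * m * (a + b) + 2 * m\<^sup>2"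
    using split[of "\<lambda>k. (\<mu> k - m)\<^sup>2 * w k"] by (simp add: P_def Q_def m0 m1 m2)
  also have "\<dots> \<le> 2 * m\<^sup>2"
  proof -
    \<comment> \<open>With \<open>m = (a + b) / 2\<close> the excess over
      \<open>2 * m\<^sup>2\<close> is a + b - 2ab, the negative of this expression.\<close>
    have "0 \<le> a * (b - 1) + b * (a - 1)" using ab by simp
    then show ?thesis by (simp add: m_def power2_eq_square field_simps)
  qed
  finally have PQ: "P + Q \<le> 2 * m\<^sup>2" .
  have 1: "\<delta>\<^sup>2 \<le> s * P"
    unfolding \<delta>_def s(1) P_def using K by (intro weighted_Cauchy_Schwarz w) (rule finite_subset[OF _ finite_lessThan])
  have 2: "\<delta>\<^sup>2 \<le> (2 - s) * Q"
    using weighted_Cauchy_Schwarz[of "{..<n} - K" w "\<lambda>k. \<mu> k - m"] w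
    unfolding \<delta>' s' Q_def by simp
  \<comment> \<open>Inside and outside \<open>K\<close> the deviations from the mean sum to \<delta>
    and -\<delta>. Weighting the two Cauchy-Schwarz bounds by the opposite masses makes
    \<open>P\<close> and \<open>Q\<close> appear with the same factor.\<close>
  have "2 * \<delta>\<^sup>2 = (2 - s) * \<delta>\<^sup>2 + s * \<delta>\<^sup>2" by (simp add: algebra_simps)
  also have "\<dots> \<le> (2 - s) * (s * P) + s * ((2 - s) * Q)"
    using 1 2 s0 s2 by (intro add_mono mult_left_mono) auto
  also have "\<dots> = s * (2 - s) * (P + Q)" by (simp add: algebra_simps)
  also have "\<dots> \<le> s * (2 - s) * (2 * m\<^sup>2)"
    using s0 s2 by (intro mult_left_mono[OF PQ] mult_nonneg_nonneg) auto
  finally have d: "\<delta>\<^sup>2 \<le> s * (2 - s) * m\<^sup>2" by simp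
  \<comment> \<open>The factor is 55/100 + x = 1 - (45/100 - x), the share of the mean that may be
    lost. The quotient s/(2 - s) increases with s, so the threshold value s = 45/100 + x decides,
    where 2 - s = 155/100 - x; at x = 0 the margin is 151/8000.\<close>
  have "s \<le> (55 / 100 + x)\<^sup>2 * (2 - s)"
  proof -
    have "45 / 100 + x \<le> (55 / 100 + x)\<^sup>2 * (155 / 100 - x)"
    proof -
      have "(55 / 100 + x)\<^sup>2 * (155 / 100 - x) - (45 / 100 + x) =
          151 / 8000 + x / 400 + x * (4 / 10 - x\<^sup>2) + 45 / 100 * x\<^sup>2"
        by (simp add: power2_eq_square field_simps)
      moreover have "0 \<le> x * (4 / 10 - x\<^sup>2)"
        using x power_mono[of x "6 / 100" 2] by (simp add: power2_eq_square)
      ultimately show ?thesis using x(1) zero_le_power2[of x] by linarith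
    qed
    also have "\<dots> \<le> (55 / 100 + x)\<^sup>2 * (2 - s)"
      using s(2) by (intro mult_left_mono) auto
    finally show ?thesis using s(2) by simp
  qed
  then have "s * (2 - s) * m\<^sup>2 \<le> (55 / 100 + x)\<^sup>2 * (2 - s) * (2 - s) * m\<^sup>2"
    using s2 by (intro mult_right_mono) auto
  also have "\<dots> = ((55 / 100 + x) * (2 - s) * m)\<^sup>2"
    unfolding power2_eq_square by (simp only: mult_ac)
  finally have "\<delta>\<^sup>2 \<le> ((55 / 100 + x) * (2 - s) * m)\<^sup>2"
    using d by linarith
  moreover have "0 \<le> (55 / 100 + x) * (2 - s) * m"
    using x s2 m by (intro mult_nonneg_nonneg) auto
  ultimately have "\<delta> \<le> (55 / 100 + x) * (2 - s) * m"
    by (rule power2_le_imp_le)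
  moreover have "(\<Sum>k\<in>{..<n} - K. \<mu> k * w k) =
      (\<Sum>k\<in>{..<n} - K. (\<mu> k - m) * w k) + m * (\<Sum>k\<in>{..<n} - K. w k)"
    by (simp add: sum_distrib_left sum_subtractf algebra_simps)
  then have "(\<Sum>k\<in>{..<n} - K. \<mu> k * w k) = m * (2 - s) - \<delta>"
    by (simp add: \<delta>' s')
  moreover have "m * ((2 - s) * (45 / 100 - x)) = m * (2 - s) - (55 / 100 + x) * (2 - s) * m"
    by (simp add: field_simps)
  ultimately have "m * ((2 - s) * (45 / 100 - x)) \<le> (\<Sum>k\<in>{..<n} - K. \<mu> k * w k)"
    by linarith
  \<comment> \<open>The bound obtained so far scales with the mean, and \<open>1 \<le> m\<close>
    removes it.\<close>
  moreover have "1 * ((2 - s) * (45 / 100 - x)) \<le> m * ((2 - s) * (45 / 100 - x))"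
    using m s2 x by (intro mult_right_mono) auto
  ultimately show ?thesis by (simp add: mult.commute)
qed

text \<open>
  A trial space for the perturbed operator is spanned by the eigenvectors \<open>b k\<close> with
  \<open>\<mu> k \<ge> c\<close>, to which one adds the component \<open>q\<close> of \<open>z\<close> orthogonal to them
  when \<open>z\<close> is nearly orthogonal to these eigenvectors.
\<close>

lemma rank_one_perturbation_gain:
  assumes sd: "spectral_decomposition V L b \<mu> n"
    and sd': "spectral_decomposition V L' b' \<mu>' n'"
    and L': "\<And>y. dot V (L' y) y = dot V (L y) y + (dot V z y)\<^sup>2"
    and zz: "dot V z z = 2"
    and Lz: "dot V (L z) z = d + d'" "dot V (L z) (L z) = d\<^sup>2 + d + d'\<^sup>2 + d'"
    and d: "1 \<le> d" "1 \<le> d'"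
    and x: "0 \<le> x" "x \<le> 6 / 100"
  shows "(\<Sum>k<n. max 0 (\<mu> k - (2 - 2 * x))) + 45 / 100 + x \<le> (\<Sum>k<n'. max 0 (\<mu>' k - (2 - 2 * x)))"
proof -
  interpret spectral_decomposition V L b \<mu> n by (rule sd)
  interpret P: spectral_decomposition V L' b' \<mu>' n' by (rule sd')
  define c where "c = 2 - 2 * x"
  define K where "K = {k. k < n \<and> c \<le> \<mu> k}"
  have K: "K \<subseteq> {..<n}" and finK: "finite K" and Kn: "\<And>k. k \<in> K \<Longrightarrow> k < n"
    by (auto simp: K_def)
  define w where "w k = (dot V z (b k))\<^sup>2" for k
  define s where "s = (\<Sum>k\<in>K. w k)"
  have E: "(\<Sum>k<n. max 0 (\<mu> k - c)) = (\<Sum>k\<in>K. \<mu> k - c)"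
    by (rule sum.mono_neutral_cong_right) (auto simp: K_def)
  have Lb: "dot V (L (b k)) (b k) = \<mu> k" if "k < n" for k
    using dot_L_eigenvector[OF that, of "b k"] orthonormal[OF that that] by simp
  have sumK: "(\<Sum>k\<in>K. dot V (L' (b k)) (b k) / dot V (b k) (b k) - c) = (\<Sum>k\<in>K. \<mu> k - c) + s"
    unfolding s_def sum.distrib[symmetric]
    by (intro sum.cong refl) (simp add: L' Lb Kn orthonormal w_def)
  show ?thesis unfolding c_def[symmetric]
  proof (cases "s < 45 / 100 + x")
    case False
    have "(\<Sum>k\<in>K. dot V (L' (b k)) (b k) / dot V (b k) (b k) - c) \<le> (\<Sum>k<n'. max 0 (\<mu>' k - c))"
      by (rule P.ky_fan_inequality[OF finK]) (auto simp: orthonormal Kn)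
    then show "(\<Sum>k<n. max 0 (\<mu> k - c)) + 45 / 100 + x \<le> (\<Sum>k<n'. max 0 (\<mu>' k - c))"
      using False by (simp add: sumK E)
  next
    case True
    define q where "q v = z v - (\<Sum>k\<in>K. dot V z (b k) * b k v)" for v
    have qb: "dot V q (b j) = (if j \<in> K then 0 else dot V z (b j))" if "j < n" for j
    proof -
      have "dot V q (b j) = dot V z (b j) - (\<Sum>k\<in>K. dot V z (b k) * dot V (b k) (b j))"
        unfolding q_def dot_diff_left dot_sum_left dot_scale_left ..
      also have "(\<Sum>k\<in>K. dot V z (b k) * dot V (b k) (b j)) = (\<Sum>k\<in>K. if k = j then dot V z (b j) else 0)"
        using that by (intro sum.cong refl) (auto simp: orthonormal Kn)
      finally show ?thesis using finK by simp
    qed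
    have restrict: "(\<Sum>k<n. if k \<in> K then 0 else h k) = (\<Sum>k\<in>{..<n} - K. h k)" for h :: "nat \<Rightarrow> real"
      by (rule sum.mono_neutral_cong_right) auto
    have w2: "(\<Sum>k<n. w k) = 2" using dot_self[of z] zz by (simp add: w_def)
    have "(\<Sum>k\<in>{..<n} - K. w k) = 2 - s"
      using sum.subset_diff[OF K, of w] w2 by (simp add: s_def)
    moreover have "dot V q q = (\<Sum>k\<in>{..<n} - K. w k)"
      unfolding dot_self[of q] restrict[symmetric] by (intro sum.cong refl) (auto simp: qb w_def)
    \<comment> \<open>As \<open>q\<close> is an orthogonal projection of \<open>z\<close>, its
      products with \<open>z\<close> and with itself agree.\<close>
    moreover have "dot V z q = (\<Sum>k\<in>{..<n} - K. w k)"
      unfolding parseval[of z q, symmetric] restrict[symmetric]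
      by (intro sum.cong refl) (auto simp: qb w_def power2_eq_square)
    ultimately have qq: "dot V q q = 2 - s" and zq: "dot V z q = 2 - s" by simp_all
    have Lq: "dot V (L q) q = (\<Sum>k\<in>{..<n} - K. \<mu> k * w k)"
      unfolding dot_L_self[of q] restrict[symmetric] by (intro sum.cong refl) (auto simp: qb w_def)
    have "(45 / 100 - x) * (2 - s) \<le> (\<Sum>k\<in>{..<n} - K. \<mu> k * w k)"
      using dot_L_self[of z] dot_L_L[of z] Lz
      by (intro rayleigh_bound_from_moments[OF _ K w2 _ _ d x s_def True]) (simp_all add: w_def)
    then have Rq: "(45 / 100 - x) * (2 - s) \<le> dot V (L q) q" by (simp add: Lq)
    have s2: "0 < 2 - s" using True x(2) by simp
    \<comment> \<open>The rank one term contributes (2 - s)^2 / (2 - s) = 2 - s. Together with the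
      gain s on \<open>K\<close> this is exactly 2, which cancels the 2 in c = 2 - 2x and leaves
      45/100 - x + 2x.\<close>
    have R: "45 / 100 - x + (2 - s) \<le> dot V (L' q) q / dot V q q"
      unfolding L' qq zq using Rq s2 by (simp add: field_simps power2_eq_square)
    \<comment> \<open>All elements of \<open>K\<close> are below \<open>n\<close>, so the index
      \<open>n\<close> is free for \<open>q\<close>.\<close>
    define f where "f k = (if k = n then q else b k)" for k
    have nK: "n \<notin> K" by (auto simp: K_def)
    have orth: "dot V (f i) (f j) = 0" if "i \<in> insert n K" "j \<in> insert n K" "i \<noteq> j" for i j
      using that qb Kn nK by (auto simp: f_def orthonormal dot_commute[of V "b _" q])
    have pos: "0 < dot V (f i) (f i)" if "i \<in> insert n K" for i
      using that s2 qq Kn by (auto simp: f_def orthonormal)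
    have "(\<Sum>k\<in>insert n K. dot V (L' (f k)) (f k) / dot V (f k) (f k) - c) \<le> (\<Sum>k<n'. max 0 (\<mu>' k - c))"
      by (rule P.ky_fan_inequality[OF finite.insertI[OF finK] orth pos])
    also have "(\<Sum>k\<in>insert n K. dot V (L' (f k)) (f k) / dot V (f k) (f k) - c) =
        dot V (L' q) q / dot V q q - c + (\<Sum>k\<in>K. dot V (L' (b k)) (b k) / dot V (b k) (b k) - c)"
      using finK nK by (subst sum.insert) (auto simp: f_def intro!: sum.cong)
    finally show "(\<Sum>k<n. max 0 (\<mu> k - c)) + 45 / 100 + x \<le> (\<Sum>k<n'. max 0 (\<mu>' k - c))"
      using R unfolding sumK E by (simp add: c_def)
  qed
qed

section \<open>The Laplacian of a graph\<close>

definition laplacian :: "'a pair_pre_digraph \<Rightarrow> ('a \<Rightarrow> real) \<Rightarrow> 'a \<Rightarrow> real" where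
  "laplacian G x v = (\<Sum>w | (v, w) \<in> parcs G. x v - x w)"

lemma pair_graphD:
  assumes "pair_graph G"
  shows finite_pverts: "finite (pverts G)" and finite_parcs: "finite (parcs G)"
    and parcs_sym: "(a, b) \<in> parcs G \<Longrightarrow> (b, a) \<in> parcs G"
    and parcs_irrefl: "(a, a) \<notin> parcs G"
    and parcs_in_pverts: "(a, b) \<in> parcs G \<Longrightarrow> a \<in> pverts G" "(a, b) \<in> parcs G \<Longrightarrow> b \<in> pverts G"
proof -
  interpret pair_graph G by (rule assms)
  show "finite (pverts G)" "finite (parcs G)" by (rule pair_finite_verts pair_finite_arcs)+
  show "(a, b) \<in> parcs G \<Longrightarrow> (b, a) \<in> parcs G" by (rule arcs_symmetric)
  show "(a, a) \<notin> parcs G" using no_loops' by blast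
  show "(a, b) \<in> parcs G \<Longrightarrow> a \<in> pverts G" "(a, b) \<in> parcs G \<Longrightarrow> b \<in> pverts G"
    using wellformed' by blast+
qed

lemma pair_graphI:
  assumes "finite (pverts G)"
    and "\<And>a b. (a, b) \<in> parcs G \<Longrightarrow> (b, a) \<in> parcs G"
    and "\<And>a. (a, a) \<notin> parcs G"
    and "\<And>a b. (a, b) \<in> parcs G \<Longrightarrow> a \<in> pverts G \<and> b \<in> pverts G"
  shows "pair_graph G"
proof -
  have "finite (parcs G)"
    using assms(1,4) by (intro finite_subset[of "parcs G" "pverts G \<times> pverts G"]) auto
  then show ?thesis
    using assms by unfold_locales (auto simp: symmetric_def sym_def)
qed

lemma finite_neighbours: "pair_graph G \<Longrightarrow> finite {w. (v, w) \<in> parcs G}"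
  by (rule finite_subset[OF _ finite_pverts]) (auto dest: parcs_in_pverts)

lemma vertex_degree_eq: "vertex_degree G v = card {w. (v, w) \<in> parcs G}"
proof -
  have "out_arcs (with_proj G) v = Pair v ` {w. (v, w) \<in> parcs G}"
    by (auto simp: out_arcs_def)
  then show ?thesis
    by (simp add: vertex_degree_def out_degree_def card_image inj_on_def)
qed

lemma sum_neighbours:
  assumes G: "pair_graph G"
  shows "(\<Sum>v\<in>pverts G. \<Sum>w | (v, w) \<in> parcs G. h v w) = (\<Sum>(v, w)\<in>parcs G. h v w)"
proof -
  have "parcs G = (SIGMA v:pverts G. {w. (v, w) \<in> parcs G})"
    using parcs_in_pverts[OF G] by auto
  then show ?thesis
    using finite_pverts[OF G] finite_neighbours[OF G] by (simp add: sum.Sigma)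
qed

lemma sum_parcs_swap:
  assumes G: "pair_graph G"
  shows "(\<Sum>(v, w)\<in>parcs G. h v w) = (\<Sum>(v, w)\<in>parcs G. h w v)"
  by (rule sum.reindex_bij_witness[of _ prod.swap prod.swap]) (auto intro: parcs_sym[OF G])

text \<open>Averaging the sum over arcs with its reversed copy produces the symmetric form; the
  division by 2 reflects that every edge is present as two arcs.\<close>

lemma dot_laplacian:
  assumes G: "pair_graph G"
  shows "dot (pverts G) (laplacian G x) y = (\<Sum>(v, w)\<in>parcs G. (x v - x w) * (y v - y w)) / 2"
proof -
  have "dot (pverts G) (laplacian G x) y = (\<Sum>v\<in>pverts G. \<Sum>w | (v, w) \<in> parcs G. (x v - x w) * y v)"
    by (simp add: dot_def laplacian_def sum_distrib_right)
  also have "\<dots> = (\<Sum>(v, w)\<in>parcs G. (x v - x w) * y v)"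
    by (rule sum_neighbours[OF G])
  finally have 1: "dot (pverts G) (laplacian G x) y = (\<Sum>(v, w)\<in>parcs G. (x v - x w) * y v)" .
  moreover have "(\<Sum>(v, w)\<in>parcs G. (x v - x w) * y v) = (\<Sum>(v, w)\<in>parcs G. (x w - x v) * y w)"
    by (rule sum_parcs_swap[OF G])
  ultimately have "2 * dot (pverts G) (laplacian G x) y =
      (\<Sum>(v, w)\<in>parcs G. (x v - x w) * y v) + (\<Sum>(v, w)\<in>parcs G. (x w - x v) * y w)"
    by simp
  also have "\<dots> = (\<Sum>(v, w)\<in>parcs G. (x v - x w) * (y v - y w))"
    unfolding sum.distrib[symmetric] by (intro sum.cong refl) (auto simp: algebra_simps)
  finally show ?thesis by simp
qed

lemma laplacian_self_adjoint:
  "pair_graph G \<Longrightarrow> dot (pverts G) (laplacian G x) y = dot (pverts G) x (laplacian G y)"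
  unfolding dot_commute[of _ x] by (simp add: dot_laplacian mult.commute)

lemma card_parcs_eq:
  assumes G: "pair_graph G"
  shows "card (parcs G) = 2 * card (graph_edges G)"
proof -
  define f where "f = (\<lambda>(u, v). {u, v} :: 'a set)"
  have edges: "graph_edges G = f ` parcs G"
    by (auto simp: graph_edges_def f_def)
  have "card (parcs G) = (\<Sum>e\<in>graph_edges G. card {a \<in> parcs G. f a = e})"
    unfolding edges using sum.image_gen[OF finite_parcs[OF G], of "\<lambda>_. 1 :: nat" f] by simp
  also have "\<dots> = (\<Sum>e\<in>graph_edges G. 2)"
  proof (rule sum.cong[OF refl])
    fix e assume "e \<in> graph_edges G"
    then obtain u v where uv: "(u, v) \<in> parcs G" "e = {u, v}"
      by (auto simp: graph_edges_def)
    have "{a \<in> parcs G. f a = e} = {(u, v), (v, u)}"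
    proof (intro equalityI subsetI)
      fix a assume "a \<in> {a \<in> parcs G. f a = e}"
      then have "{fst a, snd a} = {u, v}" by (simp add: f_def uv(2) case_prod_unfold)
      then show "a \<in> {(u, v), (v, u)}"
        unfolding doubleton_eq_iff by (cases a) simp
    next
      fix a assume "a \<in> {(u, v), (v, u)}"
      then show "a \<in> {a \<in> parcs G. f a = e}"
        using uv(1) parcs_sym[OF G uv(1)] by (elim insertE) (simp_all add: f_def uv(2) insert_commute)
    qed
    moreover have "u \<noteq> v" using uv parcs_irrefl[OF G] by blast
    ultimately show "card {a \<in> parcs G. f a = e} = 2" by simp
  qed
  finally show ?thesis by simp
qed

lemma laplacian_matrix_index:
  assumes "i < length vs" "j < length vs"
  shows "laplacian_matrix G vs $$ (i, j) =
    (if i = j then real (vertex_degree G (vs ! i)) else 0) - (if (vs ! i, vs ! j) \<in> parcs G then 1 else 0)"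
  using assms by (simp add: laplacian_matrix_def degree_matrix_def adjacency_matrix_def)

lemma laplacian_matrix_carrier: "laplacian_matrix G vs \<in> carrier_mat (length vs) (length vs)"
  by (simp add: laplacian_matrix_def degree_matrix_def adjacency_matrix_def minus_carrier_mat)

lemma laplacian_matrix_mult:
  assumes G: "pair_graph G" and vs: "distinct vs" "set vs = pverts G" and i: "i < length vs"
  shows "(\<Sum>j<length vs. laplacian_matrix G vs $$ (i, j) * x (vs ! j)) = laplacian G x (vs ! i)"
proof -
  have bij: "bij_betw ((!) vs) {..<length vs} (pverts G)"
    using bij_betw_nth[OF vs(1) refl refl] vs(2) by simp
  have "(\<Sum>j<length vs. laplacian_matrix G vs $$ (i, j) * x (vs ! j)) =
      (\<Sum>j<length vs. if i = j then real (vertex_degree G (vs ! i)) * x (vs ! i) else 0) -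
      (\<Sum>j<length vs. if (vs ! i, vs ! j) \<in> parcs G then x (vs ! j) else 0)"
    unfolding sum_subtractf[symmetric] using i
    by (intro sum.cong refl) (auto simp: laplacian_matrix_index left_diff_distrib)
  also have "(\<Sum>j<length vs. if (vs ! i, vs ! j) \<in> parcs G then x (vs ! j) else 0) =
      (\<Sum>w\<in>pverts G. if (vs ! i, w) \<in> parcs G then x w else 0)"
    by (rule sum.reindex_bij_betw[OF bij])
  also have "\<dots> = (\<Sum>w | (vs ! i, w) \<in> parcs G. x w)"
    using finite_pverts[OF G] parcs_in_pverts[OF G] by (intro sum.mono_neutral_cong_right) auto
  finally show ?thesis
    using i by (simp add: laplacian_def sum_subtractf vertex_degree_eq)
qed

lemma proots_linear_factors: "proots (\<Prod>a\<leftarrow>as. [:- a, 1:]) = mset (as :: real list)"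
proof (induction as)
  case (Cons a as)
  have "(\<Prod>a\<leftarrow>as. [:- a, 1:]) \<noteq> (0 :: real poly)"
    by (auto simp: prod_list_zero_iff)
  with Cons show ?case by (simp add: proots_mult del: mult_pCons_left)
qed simp

text \<open>The bridge from the characteristic polynomial, which defines the eigenvalues, to an
  orthonormal eigenbasis of functions on the vertices: similarity to a diagonal matrix preserves the
  polynomial, so the same \<open>\<mu>\<close> lists its roots with multiplicity.\<close>

theorem laplacian_spectral_decomposition:
  fixes G :: "'a pair_pre_digraph"
  assumes G: "pair_graph G"
  obtains b \<mu> where "spectral_decomposition (pverts G) (laplacian G) b \<mu> (card (pverts G))"
    and "laplacian_eigenvalues G = mset (map \<mu> [0..<card (pverts G)])"
proof -
  obtain vs where vs: "set vs = pverts G" "distinct vs"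
    using finite_distinct_list[OF finite_pverts[OF G]] by blast
  define n where "n = length vs"
  have n: "n = card (pverts G)" using vs by (metis distinct_card n_def)
  define A where "A = laplacian_matrix G vs"
  have A: "A \<in> carrier_mat n n" unfolding A_def n_def by (rule laplacian_matrix_carrier)
  have "transpose_mat A = A"
    using parcs_sym[OF G] A
    by (intro eq_matI) (auto simp: A_def laplacian_matrix_index n_def)
  from symmetric_mat_diagonalization[OF A this]
  obtain U \<mu> where U: "U \<in> carrier_mat n n" "transpose_mat U * U = 1\<^sub>m n"
    and AU: "A * U = U * mat_diag n \<mu>"
    by blast
  define D where "D = mat_diag n \<mu>"
  have D: "D \<in> carrier_mat n n" by (simp add: D_def mat_diag_def)
  have Ut: "transpose_mat U \<in> carrier_mat n n" using U(1) by simp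
  have UU: "U * transpose_mat U = 1\<^sub>m n"
    using mat_mult_left_right_inverse[OF Ut U(1,2)] .
  have "A = (U * D) * transpose_mat U"
    unfolding D_def AU[symmetric] assoc_mult_mat[OF A U(1) Ut] UU using A by simp
  then have "similar_mat_wit A D U (transpose_mat U)"
    by (rule similar_mat_witI[OF UU U(2) _ A D U(1) Ut])
  then have sim: "similar_mat A D"
    unfolding similar_mat_def by blast
  have upper: "upper_triangular D"
    by (rule upper_triangularI) (simp add: D_def mat_diag_def)
  have "char_poly A = (\<Prod>a\<leftarrow>diag_mat D. [:- a, 1:])"
    using char_poly_similar[OF sim] char_poly_upper_triangular[OF D] upper by simp
  also have "diag_mat D = map \<mu> [0..<n]"
    using D by (auto simp: diag_mat_def D_def mat_diag_def)
  finally have eigs: "laplacian_eigenvalues G = mset (map \<mu> [0..<n])"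
    unfolding laplacian_eigenvalues_eq[OF vs(2,1)] A_def[symmetric] by (simp only: proots_linear_factors)
  have bij: "bij_betw ((!) vs) {..<n} (pverts G)"
    using bij_betw_nth[OF vs(2) refl refl] vs(1) by (simp add: n_def)
  define idx where "idx = the_inv_into {..<n} ((!) vs)"
  have idx: "idx (vs ! i) = i" if "i < n" for i
    unfolding idx_def using bij that by (intro the_inv_into_f_f) (auto simp: bij_betw_def)
  define b where "b k v = U $$ (idx v, k)" for k v
  have vsE: "\<exists>i<n. v = vs ! i" if "v \<in> pverts G" for v
    using that in_set_conv_nth[of v vs] vs(1) by (auto simp: n_def)
  have "spectral_decomposition (pverts G) (laplacian G) b \<mu> n"
  proof
    show "finite (pverts G)" by (rule finite_pverts[OF G])
    show "dot (pverts G) (laplacian G x) y = dot (pverts G) x (laplacian G y)" for x y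
      by (rule laplacian_self_adjoint[OF G])
  next
    fix i j assume ij: "i < n" "j < n"
    have "dot (pverts G) (b i) (b j) = (\<Sum>k<n. b i (vs ! k) * b j (vs ! k))"
      unfolding dot_def by (rule sum.reindex_bij_betw[OF bij, symmetric])
    also have "\<dots> = (transpose_mat U * U) $$ (i, j)"
      using U(1) ij by (simp add: b_def idx scalar_prod_def atLeast0LessThan)
    finally show "dot (pverts G) (b i) (b j) = (if i = j then 1 else 0)"
      using U(2) ij by simp
  next
    fix v w assume "v \<in> pverts G" "w \<in> pverts G"
    then obtain i j where ij: "i < n" "v = vs ! i" "j < n" "w = vs ! j" using vsE by blast
    have "(\<Sum>k<n. b k v * b k w) = (U * transpose_mat U) $$ (i, j)"
      using U(1) ij by (simp add: b_def idx scalar_prod_def atLeast0LessThan)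
    also have "\<dots> = (if i = j then 1 else 0)" using UU ij by simp
    also have "i = j \<longleftrightarrow> v = w"
      using ij vs(2) by (auto simp: n_def nth_eq_iff_index_eq)
    finally show "(\<Sum>k<n. b k v * b k w) = (if v = w then 1 else 0)" .
  next
    fix k v assume k: "k < n" and "v \<in> pverts G"
    then obtain i where i: "i < n" "v = vs ! i" using vsE by blast
    have "laplacian G (b k) v = (\<Sum>j<n. A $$ (i, j) * b k (vs ! j))"
      unfolding i(2) A_def n_def using i(1)
      by (intro laplacian_matrix_mult[OF G vs(2,1), symmetric]) (simp add: n_def)
    also have "\<dots> = (A * U) $$ (i, k)"
      using A U(1) i k by (simp add: b_def idx scalar_prod_def atLeast0LessThan)
    also have "\<dots> = (\<Sum>j<n. U $$ (i, j) * (if j = k then \<mu> k else 0))"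
      unfolding AU using U(1) i k
      by (simp add: scalar_prod_def atLeast0LessThan mat_diag_def)
    also have "\<dots> = (\<Sum>j<n. if j = k then U $$ (i, k) * \<mu> k else 0)"
      by (intro sum.cong) auto
    also have "\<dots> = \<mu> k * b k v"
      using k i by (simp add: b_def idx)
    finally show "laplacian G (b k) v = \<mu> k * b k v" .
  qed
  then show ?thesis using that eigs unfolding n by blast
qed

text \<open>Summing the Rayleigh quotients over the basis and exchanging sums, completeness makes
  each arc contribute exactly 1: the square part gives 1 and the mixed part 0, as the ends of an arc
  differ.\<close>

lemma laplacian_trace:
  assumes G: "pair_graph G"
    and sd: "spectral_decomposition (pverts G) (laplacian G) b \<mu> n"
  shows "(\<Sum>k<n. \<mu> k) = 2 * real (card (graph_edges G))"
proof -
  interpret spectral_decomposition "pverts G" "laplacian G" b \<mu> n by (rule sd)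
  have "(\<Sum>k<n. \<mu> k) = (\<Sum>k<n. dot (pverts G) (laplacian G (b k)) (b k))"
    by (intro sum.cong refl) (simp add: dot_L_eigenvector orthonormal)
  also have "\<dots> = (\<Sum>k<n. \<Sum>v\<in>pverts G. \<Sum>w | (v, w) \<in> parcs G. (b k v - b k w) * b k v)"
    by (simp add: dot_def laplacian_def sum_distrib_right)
  also have "\<dots> = (\<Sum>k<n. \<Sum>(v, w)\<in>parcs G. (b k v - b k w) * b k v)"
    by (intro sum.cong refl sum_neighbours[OF G])
  also have "\<dots> = (\<Sum>(v, w)\<in>parcs G. \<Sum>k<n. (b k v - b k w) * b k v)"
    by (subst sum.swap) (simp add: case_prod_unfold)
  also have "\<dots> = (\<Sum>(v, w)\<in>parcs G. 1)"
  proof (intro sum.cong refl, clarify)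
    fix v w assume vw: "(v, w) \<in> parcs G"
    then have "v \<in> pverts G" "w \<in> pverts G" "w \<noteq> v"
      using parcs_in_pverts[OF G] parcs_irrefl[OF G] by auto
    then show "(\<Sum>k<n. (b k v - b k w) * b k v) = 1"
      by (simp add: left_diff_distrib sum_subtractf complete)
  qed
  also have "\<dots> = real (card (parcs G))" by simp
  finally show ?thesis by (simp add: card_parcs_eq[OF G])
qed

lemma laplacian_energy_eq:
  assumes G: "pair_graph G" and V: "pverts G \<noteq> {}"
    and sd: "spectral_decomposition (pverts G) (laplacian G) b \<mu> (card (pverts G))"
    and ev: "laplacian_eigenvalues G = mset (map \<mu> [0..<card (pverts G)])"
  shows "laplacian_energy G = 2 * (\<Sum>k<card (pverts G). max 0 (\<mu> k - average_degree G))"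
    and "(\<Sum>k<card (pverts G). \<mu> k - average_degree G) = 0"
proof -
  let ?n = "card (pverts G)" and ?c = "average_degree G"
  have n: "?n \<noteq> 0" using V finite_pverts[OF G] by simp
  show 0: "(\<Sum>k<?n. \<mu> k - ?c) = 0"
    using laplacian_trace[OF G sd] n by (simp add: sum_subtractf average_degree_def)
  have "laplacian_energy G = (\<Sum>k<?n. \<bar>\<mu> k - ?c\<bar>)"
    unfolding laplacian_energy_def ev
    by (simp add: sum_mset_sum_list interv_sum_list_conv_sum_set_nat atLeast0LessThan flip: mset_map)
  also have "\<dots> = (\<Sum>k<?n. 2 * max 0 (\<mu> k - ?c) - (\<mu> k - ?c))"
    by (intro sum.cong refl) (simp add: max_def abs_if)
  finally show "laplacian_energy G = 2 * (\<Sum>k<?n. max 0 (\<mu> k - ?c))"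
    using 0 by (simp add: sum_subtractf sum_distrib_left)
qed

section \<open>Trees\<close>

text \<open>These are the arcs of G - v, kept as a relation so that its reflexive transitive closure
  expresses connection in G - v.\<close>

definition avoiding :: "'a pair_pre_digraph \<Rightarrow> 'a \<Rightarrow> ('a \<times> 'a) set" where
  "avoiding G v = {(a, b) \<in> parcs G. a \<noteq> v \<and> b \<noteq> v}"

lemma is_tree_pair_graph: "is_tree G \<Longrightarrow> pair_graph G"
  by (simp add: is_tree_def)

lemma is_tree_nonempty: "is_tree G \<Longrightarrow> pverts G \<noteq> {}"
  by (auto simp: is_tree_def Digraph_Component.connected_def strongly_connected_def mk_symmetric_def)

lemma is_tree_connected:
  assumes T: "is_tree G" and "a \<in> pverts G" "b \<in> pverts G"
  shows "(a, b) \<in> (parcs G)\<^sup>*"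
proof -
  have G: "pair_graph G" using T by (rule is_tree_pair_graph)
  have parcs: "parcs (mk_symmetric (with_proj G)) = parcs G"
    using parcs_sym[OF G] by (auto simp: mk_symmetric_def)
  have "(a, b) \<in> rtrancl_on (pverts G) (parcs G)"
    using T assms(2,3) parcs
    by (simp add: is_tree_def Digraph_Component.connected_def strongly_connected_def reachable_def mk_symmetric_def)
  then show ?thesis
    by (induction rule: rtrancl_on_induct) auto
qed

text \<open>A path from \<open>a\<close> to \<open>b\<close> in G - v, closed up through
  \<open>v\<close>, would be a cycle. It has two arcs at \<open>v\<close> and at least one more if
  \<open>a\<close> and \<open>b\<close> differ, hence the required three. Later arguments use
  acyclicity in this form.\<close>

lemma acyclic_neighbours:
  assumes T: "is_tree G" and va: "(v, a) \<in> parcs G" and vb: "(v, b) \<in> parcs G"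
    and ab: "(a, b) \<in> (avoiding G v)\<^sup>*"
  shows "a = b"
proof (rule ccontr)
  assume "a \<noteq> b"
  have G: "pair_graph G" using T by (rule is_tree_pair_graph)
  interpret G: pair_graph G by (rule G)
  define H where "H = \<lparr> pverts = pverts G - {v}, parcs = avoiding G v \<rparr>"
  interpret H: pair_wf_digraph H
    by unfold_locales (auto simp: H_def avoiding_def dest: parcs_in_pverts[OF G])
  have a: "a \<in> pverts H"
    using va parcs_in_pverts[OF G] parcs_irrefl[OF G] by (auto simp: H_def)
  from ab have "a \<rightarrow>\<^sup>*\<^bsub>with_proj H\<^esub> b"
  proof (induction rule: rtrancl_induct)
    case base
    then show ?case using a by (simp add: reachable_def)
  next
    case (step y z)
    then have "z \<in> pverts H" "(y, z) \<in> parcs H"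
      using parcs_in_pverts[OF G] by (auto simp: H_def avoiding_def)
    with step show ?case by (auto simp: reachable_def intro: rtrancl_on_into_rtrancl_on)
  qed
  then obtain p where p: "H.apath a p b" using H.reachable_apath by blast
  have p_arcs: "set p \<subseteq> avoiding G v" and cas: "pcas a p b" and dist: "distinct (pawalk_verts a p)"
  proof -
    have "H.awalk a p b" "distinct (pawalk_verts a p)" using p by (simp_all add: H.apath_def)
    then show "set p \<subseteq> avoiding G v" "pcas a p b" "distinct (pawalk_verts a p)"
      by (simp_all add: H.awalk_def) (simp add: H_def)
  qed
  have "p \<noteq> []" using cas \<open>a \<noteq> b\<close> by auto
  have v: "v \<notin> set (pawalk_verts a p)"
  proof -
    have "set (pawalk_verts x q) \<subseteq> insert x (snd ` set q \<union> fst ` set q)" for x and q :: "('a \<times> 'a) list"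
      by (induction q arbitrary: x) auto
    then show ?thesis using p_arcs a by (fastforce simp: H_def avoiding_def)
  qed
  define c where "c = (v, a) # p @ [(b, v)]"
  have cas_app: "pcas x q y \<Longrightarrow> pcas x (q @ [(y, z)]) z \<and> pawalk_verts x (q @ [(y, z)]) = pawalk_verts x q @ [z]"
    for x y z and q :: "('a \<times> 'a) list"
    by (induction q arbitrary: x) auto
  have "G.cycle c"
    unfolding G.cycle_def
  proof (intro exI[of _ v] conjI)
    show "G.awalk v c v"
      using va vb p_arcs cas cas_app[OF cas, of v] parcs_sym[OF G vb] parcs_in_pverts[OF G]
      by (auto simp: G.awalk_def c_def avoiding_def)
    have "tl (pawalk_verts v c) = pawalk_verts a p @ [v]"
      unfolding conjunct2[OF cas_app[OF cas, of v], symmetric] by (simp add: c_def)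
    then show "distinct (tl (pawalk_verts v c))"
      using dist v by simp
    show "c \<noteq> []" by (simp add: c_def)
  qed
  moreover have "3 \<le> length c"
    using \<open>p \<noteq> []\<close> by (cases p) (auto simp: c_def)
  ultimately show False using T by (auto simp: is_tree_def)
qed

text \<open>Root the tree at \<open>r\<close>. Every other vertex has exactly one neighbour that is
  not farther from the root, its parent \<open>\<pi> v\<close>, and sending \<open>v\<close> to the
  edge towards its parent is a bijection onto the edges.\<close>

theorem tree_card_edges:
  assumes T: "is_tree G"
  shows "card (graph_edges G) + 1 = card (pverts G)"
proof -
  have G: "pair_graph G" using T by (rule is_tree_pair_graph)
  obtain r where r: "r \<in> pverts G" using is_tree_nonempty[OF T] by blast
  define d where "d v = (LEAST k. (r, v) \<in> parcs G ^^ k)" for v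
  have dE: "(r, v) \<in> parcs G ^^ d v" if "v \<in> pverts G" for v
  proof -
    have "\<exists>k. (r, v) \<in> parcs G ^^ k"
      using is_tree_connected[OF T r that] by (simp add: rtrancl_power)
    then show ?thesis unfolding d_def by (rule LeastI_ex)
  qed
  have d_le: "d v \<le> k" if "(r, v) \<in> parcs G ^^ k" for v k
    unfolding d_def using that by (rule Least_le)
  have d0: "d r = 0" using d_le[of r 0] by simp
  have parent: "\<exists>p. (v, p) \<in> parcs G \<and> d p < d v" if v: "v \<in> pverts G" "v \<noteq> r" for v
  proof -
    have "d v \<noteq> 0" using dE[OF v(1)] v(2) by (intro notI) simp
    then obtain k where k: "d v = Suc k" by (cases "d v") auto
    then obtain p where p: "(r, p) \<in> parcs G ^^ k" "(p, v) \<in> parcs G"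
      using dE[OF v(1)] by auto
    then show ?thesis using d_le[OF p(1)] k parcs_sym[OF G] by (intro exI[of _ p]) auto
  qed
  (* The steps towards the root decrease the distance, so they avoid every vertex v that is not nearer. *)
  have to_root: "(x, r) \<in> (avoiding G v)\<^sup>*" if "x \<in> pverts G" "x \<noteq> v" "d x \<le> d v" for x v
    using that
  proof (induction "d x" arbitrary: x rule: less_induct)
    case less
    show ?case
    proof (cases "x = r")
      case False
      then obtain p where p: "(x, p) \<in> parcs G" "d p < d x" using parent less.prems by blast
      then have "(p, r) \<in> (avoiding G v)\<^sup>*"
        using less.hyps[OF p(2)] less.prems parcs_in_pverts[OF G p(1)] p(2) by fastforce
      moreover have "(x, p) \<in> avoiding G v" using p less.prems by (auto simp: avoiding_def)
      ultimately show ?thesis by (rule converse_rtrancl_into_rtrancl[rotated])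
    qed simp
  qed
  \<comment> \<open>Both neighbours reach the root without passing through \<open>v\<close>, so they
    are connected in G - v. Allowing equal distance also rules out edges within one level, since the
    parent is strictly nearer.\<close>
  have unique: "a = b" if "(v, a) \<in> parcs G" "(v, b) \<in> parcs G" "d a \<le> d v" "d b \<le> d v" for v a b
  proof (rule acyclic_neighbours[OF T that(1,2)])
    have ne: "a \<noteq> v" "b \<noteq> v" using that parcs_irrefl[OF G] by auto
    have ar: "(a, r) \<in> (avoiding G v)\<^sup>*" and br: "(b, r) \<in> (avoiding G v)\<^sup>*"
      using to_root that ne parcs_in_pverts[OF G] by blast+
    have "sym (avoiding G v)" using parcs_sym[OF G] by (auto simp: sym_def avoiding_def)
    then have "sym ((avoiding G v)\<^sup>*)" by (rule sym_rtrancl)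
    with ar br show "(a, b) \<in> (avoiding G v)\<^sup>*" by (meson rtrancl_trans symD)
  qed
  define \<pi> where "\<pi> v = (SOME p. (v, p) \<in> parcs G \<and> d p < d v)" for v
  have \<pi>: "(v, \<pi> v) \<in> parcs G" "d (\<pi> v) < d v" if "v \<in> pverts G" "v \<noteq> r" for v
    using someI_ex[OF parent[OF that]] by (auto simp: \<pi>_def)
  have \<pi>I: "y = \<pi> x \<and> x \<noteq> r" if "(x, y) \<in> parcs G" "d y \<le> d x" for x y
  proof (cases "x = r")
    case True
    then have "d y = 0" using that d0 by simp
    then have "y = r" using dE[of y] parcs_in_pverts[OF G that(1)] by simp
    then show ?thesis using that True parcs_irrefl[OF G] by simp
  next
    case False
    then show ?thesis
      using unique[OF that(1) \<pi>(1)[OF parcs_in_pverts(1)[OF G that(1)] False] that(2)]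
        \<pi>(2)[OF parcs_in_pverts(1)[OF G that(1)] False] by simp
  qed
  have "bij_betw (\<lambda>v. {v, \<pi> v}) (pverts G - {r}) (graph_edges G)"
  proof (rule bij_betw_imageI)
    show "inj_on (\<lambda>v. {v, \<pi> v}) (pverts G - {r})"
    proof (rule inj_onI, rule ccontr)
      fix v w assume *: "v \<in> pverts G - {r}" "w \<in> pverts G - {r}" "{v, \<pi> v} = {w, \<pi> w}" "v \<noteq> w"
      then have "v = \<pi> w" "w = \<pi> v" by (auto simp: doubleton_eq_iff)
      then show False using \<pi>(2)[of v] \<pi>(2)[of w] * by auto
    qed
    show "(\<lambda>v. {v, \<pi> v}) ` (pverts G - {r}) = graph_edges G"
    proof (intro equalityI subsetI)
      fix e assume "e \<in> (\<lambda>v. {v, \<pi> v}) ` (pverts G - {r})"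
      then show "e \<in> graph_edges G" using \<pi>(1) by (auto simp: graph_edges_def)
    next
      fix e assume "e \<in> graph_edges G"
      then obtain x y where xy: "(x, y) \<in> parcs G" "e = {x, y}" by (auto simp: graph_edges_def)
      show "e \<in> (\<lambda>v. {v, \<pi> v}) ` (pverts G - {r})"
      proof (cases "d y \<le> d x")
        case True
        then show ?thesis using \<pi>I[OF xy(1)] xy parcs_in_pverts[OF G xy(1)] by auto
      next
        case False
        then show ?thesis using \<pi>I[OF parcs_sym[OF G xy(1)]] xy parcs_in_pverts[OF G xy(1)] by auto
      qed
    qed
  qed
  then have "card (graph_edges G) = card (pverts G - {r})" by (simp add: bij_betw_same_card)
  also have "\<dots> + 1 = card (pverts G)"
    using r finite_pverts[OF G] by (simp add: card_gt_0_iff) (metis Suc_pred card_gt_0_iff empty_iff)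
  finally show ?thesis by simp
qed

lemma tree_average_degree:
  assumes "is_tree G"
  shows "average_degree G = 2 - 2 / real (card (pverts G))"
proof -
  have "card (pverts G) \<noteq> 0"
    using tree_card_edges[OF assms] by simp
  moreover have "real (card (graph_edges G)) = real (card (pverts G)) - 1"
    using tree_card_edges[OF assms] by (simp add: algebra_simps flip: of_nat_Suc)
  ultimately show ?thesis by (simp add: average_degree_def field_simps)
qed

lemma tree_neighbour_exists:
  assumes T: "is_tree G" and v: "v \<in> pverts G" and card: "card (pverts G) \<ge> 2"
  obtains w where "(v, w) \<in> parcs G"
proof -
  have "\<not> pverts G \<subseteq> {v}"
    using card card_mono[of "{v}" "pverts G"] by auto
  then obtain w where w: "w \<in> pverts G" "w \<noteq> v" by blast
  have "(v, w) \<in> (parcs G)\<^sup>*" by (rule is_tree_connected[OF T v w(1)])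
  with w(2) that show ?thesis by (metis converse_rtranclE)
qed

section \<open>Structure of trees of diameter at most three\<close>

lemma walk_of_length_at_most_3:
  assumes T: "is_tree G" and diam: "graph_diameter G \<le> 3"
    and x: "x \<in> pverts G" and y: "y \<in> pverts G"
  shows "x = y \<or> (x, y) \<in> parcs G \<or> (\<exists>a. (x, a) \<in> parcs G \<and> (a, y) \<in> parcs G) \<or>
    (\<exists>a b. (x, a) \<in> parcs G \<and> (a, b) \<in> parcs G \<and> (b, y) \<in> parcs G)"
proof -
  interpret pair_graph G by (rule is_tree_pair_graph[OF T])
  have "graph_distance G x y \<le> (SUP v\<in>pverts G. graph_distance G x v)"
    by (rule SUP_upper[OF y])
  also have "\<dots> \<le> graph_diameter G"
    unfolding graph_diameter_def by (rule SUP_upper[OF x])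
  finally have le: "\<mu> (\<lambda>_. 1) x y \<le> 3"
    using diam by (simp add: graph_distance_def)
  \<comment> \<open>The distance is an infimum, so a short walk has to be extracted: lengths are
    integers, and if no walk had length at most 3, the infimum would be at least 4 (or
    infinite).\<close>
  have "\<exists>p. awalk x p y \<and> awalk_cost (\<lambda>_. 1) p \<le> 3"
  proof (rule ccontr)
    assume *: "\<nexists>p. awalk x p y \<and> awalk_cost (\<lambda>_. 1) p \<le> 3"
    have "4 \<le> \<mu> (\<lambda>_. 1) x y"
      unfolding \<mu>_def
    proof (rule INF_greatest)
      fix p assume "p \<in> {p. awalk x p y}"
      then have "\<not> real (length p) \<le> 3"
        using * by (auto simp: awalk_cost_def sum_list_triv)
      then have "4 \<le> length p" by simp
      then show "4 \<le> ereal (awalk_cost (\<lambda>_. 1) p)" by (simp add: awalk_cost_def sum_list_triv)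
    qed
    then have "(4 :: ereal) \<le> 3" using le by (rule order_trans)
    then show False by simp
  qed
  then obtain p where p: "awalk x p y" "length p \<le> 3"
    by (auto simp: awalk_cost_def sum_list_triv)
  then have "length p = 0 \<or> length p = 1 \<or> length p = 2 \<or> length p = 3" by linarith
  with p(1) show ?thesis
    by (elim disjE) (fastforce simp: awalk_def length_Suc_conv numeral_eq_Suc)+
qed

text \<open>If some edge has a further neighbour at both ends, it is the central edge of a double
  star: a vertex adjacent to neither end would close a cycle. If no edge has this property, every
  edge has a leaf at one end and the tree is a star.\<close>

lemma dominating_edge:
  assumes T: "is_tree G" and diam: "graph_diameter G \<le> 3" and card: "card (pverts G) \<ge> 3"
  obtains c c' where "(c, c') \<in> parcs G"
    and "\<And>w. w \<in> pverts G \<Longrightarrow> w \<noteq> c \<Longrightarrow> w \<noteq> c' \<Longrightarrow> (c, w) \<in> parcs G \<or> (c', w) \<in> parcs G"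
proof -
  have G: "pair_graph G" using T by (rule is_tree_pair_graph)
  note thesisI = that
  note sym = parcs_sym[OF G] and irrefl = parcs_irrefl[OF G] and inV = parcs_in_pverts[OF G]
  have tri: "\<not> ((v, a) \<in> parcs G \<and> (v, b) \<in> parcs G \<and> (a, b) \<in> parcs G)" for v a b
  proof
    assume *: "(v, a) \<in> parcs G \<and> (v, b) \<in> parcs G \<and> (a, b) \<in> parcs G"
    then have "(a, b) \<in> avoiding G v" using irrefl by (auto simp: avoiding_def)
    then have "a = b" using acyclic_neighbours[OF T, of v a b] * by blast
    then show False using * irrefl by blast
  qed
  show ?thesis
  proof (cases "\<exists>c c' x y. (c, c') \<in> parcs G \<and> (c, x) \<in> parcs G \<and> x \<noteq> c' \<and> (c', y) \<in> parcs G \<and> y \<noteq> c")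
    case True
    then obtain c c' x y where cc: "(c, c') \<in> parcs G" and x: "(c, x) \<in> parcs G" "x \<noteq> c'"
      and y: "(c', y) \<in> parcs G" "y \<noteq> c" by blast
    \<comment> \<open>Otherwise the short walks from \<open>w\<close> to \<open>x\<close> and to
      \<open>y\<close> all miss c', so \<open>w\<close> connects the two neighbours \<open>c\<close>
      and \<open>y\<close> of c' in G - c'. The ends of the edge are quantified again, because the
      fact is applied a second time with their roles exchanged.\<close>
    have near: "(c', w) \<in> parcs G \<or> (c, w) \<in> parcs G \<or> (\<exists>a. (w, a) \<in> parcs G \<and> (a, c') \<in> parcs G \<and> a \<noteq> c)"
      if cc: "(c, c') \<in> parcs G" and x: "(c, x) \<in> parcs G" "x \<noteq> c'" and y: "(c', y) \<in> parcs G" "y \<noteq> c"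
        and w: "w \<in> pverts G" "w \<noteq> c" "w \<noteq> c'" for c c' x y w
    proof (rule ccontr)
      assume neg: "\<not> ?thesis"
      let ?A = "avoiding G c'"
      have 1: "(w, y) \<in> ?A\<^sup>*"
      proof -
        have ny: "c' \<noteq> y" using y irrefl by blast
        consider "w = y" | "(w, y) \<in> parcs G" | a where "(w, a) \<in> parcs G" "(a, y) \<in> parcs G"
          | a b where "(w, a) \<in> parcs G" "(a, b) \<in> parcs G" "(b, y) \<in> parcs G"
          using walk_of_length_at_most_3[OF T diam w(1) inV(2)[OF y(1)]] by blast
        then show ?thesis
        proof cases
          case 2
          then have "(w, y) \<in> ?A" using w ny by (simp add: avoiding_def)
          then show ?thesis by blast
        next
          case 3
          then have "a \<noteq> c'" using neg sym by blast
          then have "(w, a) \<in> ?A" "(a, y) \<in> ?A" using 3 w ny by (auto simp: avoiding_def)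
          then show ?thesis by (meson converse_rtrancl_into_rtrancl r_into_rtrancl)
        next
          case 4
          have "a \<noteq> c'" using 4 neg sym by blast
          moreover have "b \<noteq> c'" using 4 neg sym by blast
          ultimately have "(w, a) \<in> ?A" "(a, b) \<in> ?A" "(b, y) \<in> ?A"
            using 4 w ny by (auto simp: avoiding_def)
          then show ?thesis by (meson converse_rtrancl_into_rtrancl r_into_rtrancl)
        qed simp
      qed
      have 2: "(w, c) \<in> ?A\<^sup>*"
      proof -
        have xc: "(x, c) \<in> ?A" using x sym cc irrefl by (auto simp: avoiding_def)
        consider "w = x" | "(w, x) \<in> parcs G" | a where "(w, a) \<in> parcs G" "(a, x) \<in> parcs G"
          | a b where "(w, a) \<in> parcs G" "(a, b) \<in> parcs G" "(b, x) \<in> parcs G"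
          using walk_of_length_at_most_3[OF T diam w(1) inV(2)[OF x(1)]] by blast
        then have "(w, x) \<in> ?A\<^sup>*"
        proof cases
          case 2
          then have "(w, x) \<in> ?A" using w x by (simp add: avoiding_def)
          then show ?thesis by blast
        next
          case 3
          then have "a \<noteq> c'" using neg sym by blast
          then have "(w, a) \<in> ?A" "(a, x) \<in> ?A" using 3 w x by (auto simp: avoiding_def)
          then show ?thesis by (meson converse_rtrancl_into_rtrancl r_into_rtrancl)
        next
          case 4
          have "a \<noteq> c'" using 4 neg sym by blast
          \<comment> \<open>Passing through c' right before \<open>x\<close> would create the
            triangle c, x, c'.\<close>
          moreover have "b \<noteq> c'" using 4(3) tri[of c x c'] x cc sym by blast
          ultimately have "(w, a) \<in> ?A" "(a, b) \<in> ?A" "(b, x) \<in> ?A"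
            using 4 w x by (auto simp: avoiding_def)
          then show ?thesis by (meson converse_rtrancl_into_rtrancl r_into_rtrancl)
        qed simp
        then show ?thesis using xc by (rule rtrancl_into_rtrancl)
      qed
      have "sym (?A\<^sup>*)" using sym by (intro sym_rtrancl) (auto simp: sym_def avoiding_def)
      then have "(c, y) \<in> ?A\<^sup>*" using 1 2 by (meson rtrancl_trans symD)
      then have "c = y" using acyclic_neighbours[OF T sym[OF cc] y(1)] by blast
      then show False using y(2) by simp
    qed
    have "(c, w) \<in> parcs G \<or> (c', w) \<in> parcs G" if w: "w \<in> pverts G" "w \<noteq> c" "w \<noteq> c'" for w
    proof (rule ccontr)
      assume neg: "\<not> ?thesis"
      \<comment> \<open>Applying \<open>near\<close> from both ends gives the closed walk c', a, w,
        a', c, in which \<open>a\<close> and \<open>c\<close> are neighbours of c' connected in G -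
        c'.\<close>
      obtain a where a: "(w, a) \<in> parcs G" "(a, c') \<in> parcs G" "a \<noteq> c"
        using near[OF cc x y w] neg by blast
      obtain a' where a': "(w, a') \<in> parcs G" "(a', c) \<in> parcs G" "a' \<noteq> c'"
        using near[OF sym[OF cc] y x w(1,3,2)] neg by blast
      have "(a, w) \<in> avoiding G c'" "(w, a') \<in> avoiding G c'" "(a', c) \<in> avoiding G c'"
        using a a' w cc sym irrefl by (auto simp: avoiding_def)
      then have "(a, c) \<in> (avoiding G c')\<^sup>*" by (meson converse_rtrancl_into_rtrancl r_into_rtrancl)
      then have "a = c" using acyclic_neighbours[OF T sym[OF a(2)] sym[OF cc]] by blast
      then show False using a(3) by simp
    qed
    then show ?thesis using that cc by blast
  next
    case False
    have ne: "pverts G \<noteq> {}" using is_tree_nonempty[OF T] .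
    then obtain v where v: "v \<in> pverts G" by blast
    obtain w where vw: "(v, w) \<in> parcs G"
      using tree_neighbour_exists[OF T v] card by auto
    \<comment> \<open>Here c' is a leaf at \<open>c\<close>. Along any walk from \<open>c\<close>
      the adjacency to \<open>c\<close> persists: a neighbour of \<open>c\<close> with yet another
      neighbour would, unless it is c', make its edge to \<open>c\<close> one of the excluded
      kind.\<close>
    have star: ?thesis if c: "(c, c') \<in> parcs G" "\<And>y. (c', y) \<in> parcs G \<Longrightarrow> y = c" for c c'
    proof (rule thesisI[OF c(1)])
      fix w assume w: "w \<in> pverts G" "w \<noteq> c" "w \<noteq> c'"
      have "(c, w) \<in> (parcs G)\<^sup>*" using is_tree_connected[OF T inV(1)[OF c(1)] w(1)] .
      then have "w = c \<or> (c, w) \<in> parcs G"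
      proof (induction rule: rtrancl_induct)
        case (step y z)
        then show ?case
          using False c sym by (metis (no_types, lifting))
      qed simp
      then show "(c, w) \<in> parcs G \<or> (c', w) \<in> parcs G" using w by blast
    qed
    show ?thesis
    proof (cases "\<forall>y. (w, y) \<in> parcs G \<longrightarrow> y = v")
      case True
      then show ?thesis using star[OF vw] by blast
    next
      case w: False
      then have "\<And>y. (v, y) \<in> parcs G \<Longrightarrow> y = w" using False vw by blast
      then show ?thesis using star[OF sym[OF vw]] by blast
    qed
  qed
qed

section \<open>Trial vectors on trees of diameter at most three\<close>

text \<open>
  By the min-max principle, the Rayleigh quotients of such a family bound the sum of the \<open>k\<close>
  largest Laplacian eigenvalues from below.
\<close>

definition has_trial_family :: "'a pair_pre_digraph \<Rightarrow> nat \<Rightarrow> real \<Rightarrow> bool" where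
  "has_trial_family G k S \<longleftrightarrow> (\<exists>f.
     (\<forall>i<k. dot (pverts G) (f i) (f i) > 0) \<and>
     (\<forall>i<k. \<forall>j<k. i \<noteq> j \<longrightarrow> dot (pverts G) (f i) (f j) = 0) \<and>
     S \<le> (\<Sum>i<k. dot (pverts G) (laplacian G (f i)) (f i) / dot (pverts G) (f i) (f i)))"

lemma has_trial_family_1I:
  assumes "dot (pverts G) f f > 0"
    and "S * dot (pverts G) f f \<le> dot (pverts G) (laplacian G f) f"
  shows "has_trial_family G 1 S"
  unfolding has_trial_family_def
  using assms by (intro exI[of _ "\<lambda>_. f"]) (simp add: field_simps)

lemma has_trial_family_2I:
  assumes "dot (pverts G) f f > 0" "dot (pverts G) g g > 0" "dot (pverts G) f g = 0"
    and "S * dot (pverts G) f f \<le> dot (pverts G) (laplacian G f) f"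
    and "S' * dot (pverts G) g g \<le> dot (pverts G) (laplacian G g) g"
  shows "has_trial_family G 2 (S + S')"
proof -
  have "S \<le> dot (pverts G) (laplacian G f) f / dot (pverts G) f f"
    "S' \<le> dot (pverts G) (laplacian G g) g / dot (pverts G) g g"
    using assms by (simp_all add: field_simps)
  then show ?thesis
    unfolding has_trial_family_def
    using assms(1-3) by (intro exI[of _ "\<lambda>i. if i = 0 then f else g"])
      (auto simp: less_2_cases_iff numeral_2_eq_2 dot_commute[of _ g f])
qed

text \<open>The listed edges are only required to be present. Further edges could only increase the
  Laplacian form, which is why \<open>laplacian_profile\<close> is an inequality.\<close>

locale double_star =
  fixes G :: "'a pair_pre_digraph" and c c' :: 'a and A B :: "'a set"
  assumes G: "pair_graph G"
    and verts: "pverts G = {c, c'} \<union> A \<union> B"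
    and distinct: "c \<noteq> c'" "c \<notin> A" "c \<notin> B" "c' \<notin> A" "c' \<notin> B" "A \<inter> B = {}"
    and edges: "(c, c') \<in> parcs G" "\<And>a. a \<in> A \<Longrightarrow> (c, a) \<in> parcs G" "\<And>b. b \<in> B \<Longrightarrow> (c', b) \<in> parcs G"
begin

lemma finite_leaves: "finite A" "finite B"
  using finite_pverts[OF G] unfolding verts by auto

lemma card_verts: "card (pverts G) = card A + card B + 2"
  unfolding verts using finite_leaves distinct by (auto simp: card_Un_disjoint card_insert_if)

lemma swap: "double_star G c' c B A"
  using G verts distinct edges parcs_sym[OF G edges(1)] by (intro double_star.intro) auto

text \<open>In a double star, vectors supported on \<open>A\<close> or on \<open>B\<close> with sum
  zero belong to the eigenvalue 1. The large eigenvalues therefore have eigenvectors constant on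
  \<open>A\<close> and on \<open>B\<close>, that is, of this shape.\<close>

definition profile :: "real \<Rightarrow> real \<Rightarrow> real \<Rightarrow> real \<Rightarrow> 'a \<Rightarrow> real" where
  "profile \<alpha> \<beta> \<gamma> \<delta> v = (if v = c then \<alpha> else if v = c' then \<beta> else if v \<in> A then \<gamma> else \<delta>)"

lemma profile_simps:
  "profile \<alpha> \<beta> \<gamma> \<delta> c = \<alpha>" "profile \<alpha> \<beta> \<gamma> \<delta> c' = \<beta>"
  "a \<in> A \<Longrightarrow> profile \<alpha> \<beta> \<gamma> \<delta> a = \<gamma>" "b \<in> B \<Longrightarrow> profile \<alpha> \<beta> \<gamma> \<delta> b = \<delta>"
  using distinct by (auto simp: profile_def)

lemma dot_profile:
  "dot (pverts G) (profile \<alpha> \<beta> \<gamma> \<delta>) (profile \<alpha>' \<beta>' \<gamma>' \<delta>') =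
    \<alpha> * \<alpha>' + \<beta> * \<beta>' + real (card A) * (\<gamma> * \<gamma>') + real (card B) * (\<delta> * \<delta>')"
proof -
  let ?h = "\<lambda>v. profile \<alpha> \<beta> \<gamma> \<delta> v * profile \<alpha>' \<beta>' \<gamma>' \<delta>' v"
  have "dot (pverts G) (profile \<alpha> \<beta> \<gamma> \<delta>) (profile \<alpha>' \<beta>' \<gamma>' \<delta>') = sum ?h {c, c'} + sum ?h A + sum ?h B"
    unfolding dot_def verts using finite_leaves distinct
    by (subst sum.union_disjoint, simp, simp, blast) (subst sum.union_disjoint, auto)
  also have "sum ?h {c, c'} = \<alpha> * \<alpha>' + \<beta> * \<beta>'" using distinct by (simp add: profile_simps)
  also have "sum ?h A = real (card A) * (\<gamma> * \<gamma>')" by (simp add: profile_simps)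
  also have "sum ?h B = real (card B) * (\<delta> * \<delta>')" by (simp add: profile_simps)
  finally show ?thesis .
qed

lemma laplacian_profile:
  "real (card A) * (\<alpha> - \<gamma>)\<^sup>2 + real (card B) * (\<beta> - \<delta>)\<^sup>2 + (\<alpha> - \<beta>)\<^sup>2
    \<le> dot (pverts G) (laplacian G (profile \<alpha> \<beta> \<gamma> \<delta>)) (profile \<alpha> \<beta> \<gamma> \<delta>)"
proof -
  let ?x = "profile \<alpha> \<beta> \<gamma> \<delta>"
  define h where "h e = (?x (fst e) - ?x (snd e))\<^sup>2" for e
  define E where "E = Pair c ` A \<union> Pair c' ` B \<union> {(c, c')}"
  have finE: "finite E" using finite_leaves by (simp add: E_def)
  have E: "E \<subseteq> parcs G" using edges by (auto simp: E_def)
  have swapE: "prod.swap ` E \<subseteq> parcs G" using E parcs_sym[OF G] by auto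
  have disj: "E \<inter> prod.swap ` E = {}" using distinct by (auto simp: E_def)
  have "sum h E = sum h (Pair c ` A) + sum h (Pair c' ` B) + h (c, c')"
    unfolding E_def using finite_leaves distinct
    by (subst sum.union_disjoint, simp, simp, blast) (subst sum.union_disjoint, auto)
  also have "sum h (Pair c ` A) = real (card A) * (\<alpha> - \<gamma>)\<^sup>2"
    by (subst sum.reindex) (auto simp: inj_on_def h_def profile_simps)
  also have "sum h (Pair c' ` B) = real (card B) * (\<beta> - \<delta>)\<^sup>2"
    by (subst sum.reindex) (auto simp: inj_on_def h_def profile_simps)
  also have "h (c, c') = (\<alpha> - \<beta>)\<^sup>2" by (simp add: h_def profile_simps)
  finally have hE: "sum h E = real (card A) * (\<alpha> - \<gamma>)\<^sup>2 + real (card B) * (\<beta> - \<delta>)\<^sup>2 + (\<alpha> - \<beta>)\<^sup>2" .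
  have "sum h (prod.swap ` E) = sum h E"
    by (subst sum.reindex) (auto simp: inj_on_def h_def power2_commute)
  then have "2 * sum h E = sum h (E \<union> prod.swap ` E)"
    using finE disj by (subst sum.union_disjoint) auto
  also have "\<dots> \<le> sum h (parcs G)"
    using E swapE finite_parcs[OF G] by (intro sum_mono2) (auto simp: h_def)
  also have "\<dots> = 2 * dot (pverts G) (laplacian G ?x) ?x"
    unfolding dot_laplacian[OF G] by (simp add: h_def case_prod_unfold power2_eq_square)
  finally show ?thesis using hE by simp
qed

text \<open>The trial vector, n - 1 at the centre and -1 at each leaf, is the eigenvector of the
  star on n vertices for its largest eigenvalue n. With \<open>B\<close> empty, c' is one of the
  leaves and the last entry is immaterial.\<close>

lemma trial_family_star:
  assumes "B = {}"
  shows "has_trial_family G 1 (real (card (pverts G)))"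
proof (rule has_trial_family_1I[where f = "profile (real (card A) + 1) (- 1) (- 1) 0"])
  show "0 < dot (pverts G) (profile (real (card A) + 1) (- 1) (- 1) 0) (profile (real (card A) + 1) (- 1) (- 1) 0)"
    unfolding dot_profile by (rule add_pos_nonneg, rule add_pos_nonneg, rule add_pos_nonneg, rule mult_pos_pos) auto
  show "real (card (pverts G)) *
      dot (pverts G) (profile (real (card A) + 1) (- 1) (- 1) 0) (profile (real (card A) + 1) (- 1) (- 1) 0)
    \<le> dot (pverts G) (laplacian G (profile (real (card A) + 1) (- 1) (- 1) 0)) (profile (real (card A) + 1) (- 1) (- 1) 0)"
    using laplacian_profile[of "real (card A) + 1" "- 1" "- 1" 0]
    unfolding dot_profile card_verts by (simp add: assms power2_eq_square algebra_simps)
qed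

text \<open>The vectors are the top eigenvectors of the two stars left after removing the central
  edge, with eigenvalues p + 1 and q + 1. Their supports are disjoint, and the central edge adds p^2
  / (p^2 + p) = p / (p + 1) to the first quotient and likewise for q.\<close>

lemma trial_family_double_star:
  assumes "A \<noteq> {}" "B \<noteq> {}"
  shows "has_trial_family G 2 (real (card (pverts G)) +
    real (card A) / (real (card A) + 1) + real (card B) / (real (card B) + 1))"
proof -
  define p q where "p = real (card A)" and "q = real (card B)"
  have p: "p > 0" "q > 0" using assms finite_leaves by (auto simp: p_def q_def card_gt_0_iff)
  have "has_trial_family G 2 ((p + 1 + p / (p + 1)) + (q + 1 + q / (q + 1)))"
  proof (rule has_trial_family_2I[where f = "profile p 0 (- 1) 0" and g = "profile 0 q 0 (- 1)"])
    show "0 < dot (pverts G) (profile p 0 (- 1) 0) (profile p 0 (- 1) 0)"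
      "0 < dot (pverts G) (profile 0 q 0 (- 1)) (profile 0 q 0 (- 1))"
      "dot (pverts G) (profile p 0 (- 1) 0) (profile 0 q 0 (- 1)) = 0"
      unfolding dot_profile p_def[symmetric] q_def[symmetric] using p by (simp_all add: add_pos_pos)
    have "(p + 1 + p / (p + 1)) * (p * p + p) = p * (p + 1)\<^sup>2 + p\<^sup>2"
      "(q + 1 + q / (q + 1)) * (q * q + q) = q * (q + 1)\<^sup>2 + q\<^sup>2"
      using p by (simp_all add: divide_simps) (simp_all add: power2_eq_square algebra_simps)
    then show "(p + 1 + p / (p + 1)) * dot (pverts G) (profile p 0 (- 1) 0) (profile p 0 (- 1) 0)
        \<le> dot (pverts G) (laplacian G (profile p 0 (- 1) 0)) (profile p 0 (- 1) 0)"
      "(q + 1 + q / (q + 1)) * dot (pverts G) (profile 0 q 0 (- 1)) (profile 0 q 0 (- 1))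
        \<le> dot (pverts G) (laplacian G (profile 0 q 0 (- 1))) (profile 0 q 0 (- 1))"
      using laplacian_profile[of p "- 1" 0 0] laplacian_profile[of 0 0 q "- 1"]
      unfolding dot_profile p_def[symmetric] q_def[symmetric] by simp_all
  qed
  moreover have "(p + 1 + p / (p + 1)) + (q + 1 + q / (q + 1)) =
      real (card (pverts G)) + p / (p + 1) + q / (q + 1)"
    by (simp add: card_verts p_def q_def)
  ultimately show ?thesis unfolding p_def q_def by simp
qed

text \<open>
  For six vertices the general family above is too weak (it gives only 7.25 and 7.33, and the
  final estimate needs 7.51), so rational approximations of the two top eigenvectors are used.
\<close>

lemma trial_family_1_3:
  assumes "card A = 1" "card B = 3"
  shows "has_trial_family G 2 (751 / 100)"
proof -
  \<comment> \<open>The two Rayleigh quotients are 101/20 = 5.05 and 192/78, slightly above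
    2.46.\<close>
  have "has_trial_family G 2 (505 / 100 + 246 / 100)"
  proof (rule has_trial_family_2I[where f = "profile (- 1) 4 0 (- 1)" and g = "profile 7 1 (- 5) (- 1)"])
    show "505 / 100 * dot (pverts G) (profile (- 1) 4 0 (- 1)) (profile (- 1) 4 0 (- 1))
        \<le> dot (pverts G) (laplacian G (profile (- 1) 4 0 (- 1))) (profile (- 1) 4 0 (- 1))"
      using laplacian_profile[of "- 1" 0 4 "- 1"] unfolding dot_profile assms by simp
    show "246 / 100 * dot (pverts G) (profile 7 1 (- 5) (- 1)) (profile 7 1 (- 5) (- 1))
        \<le> dot (pverts G) (laplacian G (profile 7 1 (- 5) (- 1))) (profile 7 1 (- 5) (- 1))"
      using laplacian_profile[of 7 "- 5" 1 "- 1"] unfolding dot_profile assms by simp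
  qed (simp_all add: dot_profile assms)
  then show ?thesis by simp
qed

lemma trial_family_2_2:
  assumes "card A = 2" "card B = 2"
  shows "has_trial_family G 2 (751 / 100)"
proof -
  \<comment> \<open>The symmetric vector is an exact eigenvector of the double star for 3. The
    antisymmetric one has quotient 520/114, close to the eigenvalue (5 + sqrt 17) / 2, about
    4.56.\<close>
  have "has_trial_family G 2 (3 + 451 / 100)"
  proof (rule has_trial_family_2I[where f = "profile 2 2 (- 1) (- 1)" and g = "profile 7 (- 7) (- 2) 2"])
    show "3 * dot (pverts G) (profile 2 2 (- 1) (- 1)) (profile 2 2 (- 1) (- 1))
        \<le> dot (pverts G) (laplacian G (profile 2 2 (- 1) (- 1))) (profile 2 2 (- 1) (- 1))"
      using laplacian_profile[of 2 "- 1" 2 "- 1"] unfolding dot_profile assms by simp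
    show "451 / 100 * dot (pverts G) (profile 7 (- 7) (- 2) 2) (profile 7 (- 7) (- 2) 2)
        \<le> dot (pverts G) (laplacian G (profile 7 (- 7) (- 2) 2)) (profile 7 (- 7) (- 2) 2)"
      using laplacian_profile[of 7 "- 2" "- 7" 2] unfolding dot_profile assms by simp
  qed (simp_all add: dot_profile assms)
  then show ?thesis by simp
qed

text \<open>The subtracted numbers measure the distance to n + 2, the limit of the general family
  for many leaves on both sides. For n = 7 the worst split is 1 + 4 leaves with 1/2 + 4/5 = 2 -
  7/10; from n = 8 on, the bound 1/2 for each fraction suffices.\<close>

lemma trial_family:
  assumes AB: "card A \<le> card B" and n: "n = card (pverts G)" "n \<ge> 6"
  shows "has_trial_family G 1 (real n) \<or>
    has_trial_family G 2 (real n + 2 - (if n = 6 then 49 / 100 else if n = 7 then 7 / 10 else 1))"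
proof (cases "A = {}")
  case True
  then show ?thesis
    using double_star.trial_family_star[OF swap] n by simp
next
  case False
  have pq: "n = card A + card B + 2" using n card_verts by simp
  have "card A \<ge> 1" using False finite_leaves by (simp add: Suc_le_eq card_gt_0_iff)
  then have "B \<noteq> {}" using AB by auto
  have mono: "has_trial_family G 2 S'" if "has_trial_family G 2 S" "S' \<le> S" for S S'
    using that unfolding has_trial_family_def by (meson order_trans)
  note dbl = trial_family_double_star[OF False \<open>B \<noteq> {}\<close>, folded n(1)]
  consider "card A = 1" "card B = 3" | "card A = 2" "card B = 2" | "card A = 1" "card B = 4"
    | "card A = 2" "card B = 3" | "n \<ge> 8"
    using pq AB n(2) \<open>card A \<ge> 1\<close> by linarith
  then show ?thesis
  proof cases
    case 1
    then show ?thesis using trial_family_1_3 pq by simp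
  next
    case 2
    then show ?thesis using trial_family_2_2 pq by simp
  next
    case 3
    then show ?thesis using mono[OF dbl] pq by simp
  next
    case 4
    then show ?thesis using mono[OF dbl] pq by simp
  next
    case 5
    have half: "1 / 2 \<le> real m / (real m + 1)" if "m \<ge> 1" for m :: nat
      using that by (simp add: field_simps)
    have "real n + 2 - 1 \<le> real n + real (card A) / (real (card A) + 1) + real (card B) / (real (card B) + 1)"
      using half[OF \<open>card A \<ge> 1\<close>] half[of "card B"] \<open>card A \<ge> 1\<close> AB by linarith
    then show ?thesis using mono[OF dbl] 5 by simp
  qed
qed

end

theorem tree_diameter_3_trial_family:
  assumes T: "is_tree G" and diam: "graph_diameter G \<le> 3" and n: "n = card (pverts G)" "n \<ge> 6"
  shows "has_trial_family G 1 (real n) \<or>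
    has_trial_family G 2 (real n + 2 - (if n = 6 then 49 / 100 else if n = 7 then 7 / 10 else 1))"
proof -
  have G: "pair_graph G" using T by (rule is_tree_pair_graph)
  obtain c c' where cc: "(c, c') \<in> parcs G"
    and dom: "\<And>w. w \<in> pverts G \<Longrightarrow> w \<noteq> c \<Longrightarrow> w \<noteq> c' \<Longrightarrow> (c, w) \<in> parcs G \<or> (c', w) \<in> parcs G"
    using dominating_edge[OF T diam] n by auto
  define A where "A = {w \<in> pverts G. w \<noteq> c \<and> w \<noteq> c' \<and> (c, w) \<in> parcs G}"
  \<comment> \<open>Taking the complement makes the cells a partition by construction; that its
    members are adjacent to c' follows from domination.\<close>
  define B where "B = pverts G - {c, c'} - A"
  interpret double_star G c c' A B
  proof (rule double_star.intro)
    show "pverts G = {c, c'} \<union> A \<union> B"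
      using parcs_in_pverts[OF G cc] by (auto simp: A_def B_def)
    show "c \<noteq> c'" using cc parcs_irrefl[OF G] by blast
    show "(c', b) \<in> parcs G" if "b \<in> B" for b using that dom[of b] by (auto simp: A_def B_def)
  qed (use G cc in \<open>auto simp: A_def B_def\<close>)
  show ?thesis
    using trial_family[OF _ n] double_star.trial_family[OF swap _ n] by linarith
qed

section \<open>Joining two graphs by an edge\<close>

definition disjoint_union :: "'a pair_pre_digraph \<Rightarrow> 'a pair_pre_digraph \<Rightarrow> 'a pair_pre_digraph" where
  "disjoint_union G H = \<lparr> pverts = pverts G \<union> pverts H, parcs = parcs G \<union> parcs H \<rparr>"

definition zero_outside :: "'a set \<Rightarrow> ('a \<Rightarrow> real) \<Rightarrow> 'a \<Rightarrow> real" where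
  "zero_outside V x v = (if v \<in> V then x v else 0)"

lemma pair_graph_disjoint_union:
  assumes G: "pair_graph G" and H: "pair_graph H"
  shows "pair_graph (disjoint_union G H)"
  using finite_pverts[OF G] finite_pverts[OF H] parcs_sym[OF G] parcs_sym[OF H]
    parcs_irrefl[OF G] parcs_irrefl[OF H] parcs_in_pverts[OF G] parcs_in_pverts[OF H]
  by (intro pair_graphI) (auto simp: disjoint_union_def)

locale two_graphs =
  fixes G H :: "'a pair_pre_digraph"
  assumes G: "pair_graph G" and H: "pair_graph H" and disjoint: "pverts G \<inter> pverts H = {}"
begin

abbreviation "U \<equiv> disjoint_union G H"

lemma U: "pair_graph U"
  by (rule pair_graph_disjoint_union[OF G H])

lemma parcs_disjoint: "parcs G \<inter> parcs H = {}"
proof -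
  have False if "(a, b) \<in> parcs G" "(a, b) \<in> parcs H" for a b
    using parcs_in_pverts(1)[OF G that(1)] parcs_in_pverts(1)[OF H that(2)] disjoint by blast
  then show ?thesis by auto
qed

lemma dot_union: "dot (pverts U) x y = dot (pverts G) x y + dot (pverts H) x y"
  using disjoint finite_pverts[OF G] finite_pverts[OF H]
  by (simp add: dot_def disjoint_union_def sum.union_disjoint)

lemma dot_laplacian_union:
  "dot (pverts U) (laplacian U x) y = dot (pverts G) (laplacian G x) y + dot (pverts H) (laplacian H x) y"
  unfolding dot_laplacian[OF G] dot_laplacian[OF H] dot_laplacian[OF U]
  using parcs_disjoint finite_parcs[OF G] finite_parcs[OF H]
  by (simp add: disjoint_union_def sum.union_disjoint add_divide_distrib)

lemma dot_laplacian_cong: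
  assumes K: "pair_graph K" and "\<And>v. v \<in> pverts K \<Longrightarrow> x v = x' v" "\<And>v. v \<in> pverts K \<Longrightarrow> y v = y' v"
  shows "dot (pverts K) (laplacian K x) y = dot (pverts K) (laplacian K x') y'"
  unfolding dot_laplacian[OF K] using assms(2,3) parcs_in_pverts[OF K]
  by (intro arg_cong2[of _ _ _ _ "(/)"] sum.cong refl) auto

lemma dot_laplacian_zero: "pair_graph K \<Longrightarrow> dot (pverts K) (laplacian K (\<lambda>_. 0)) (\<lambda>_. 0) = 0"
  by (simp add: dot_laplacian)

lemma dot_zero_outside:
  "dot (pverts U) (zero_outside (pverts G) x) (zero_outside (pverts G) y) = dot (pverts G) x y"
  "dot (pverts U) (zero_outside (pverts H) x) (zero_outside (pverts H) y) = dot (pverts H) x y"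
  "dot (pverts U) (zero_outside (pverts G) x) (zero_outside (pverts H) y) = 0"
  using disjoint unfolding dot_union
  by (auto simp: dot_def zero_outside_def disjoint_iff intro!: sum.neutral)

lemma dot_laplacian_zero_outside:
  "dot (pverts U) (laplacian U (zero_outside (pverts G) x)) (zero_outside (pverts G) x) = dot (pverts G) (laplacian G x) x"
  "dot (pverts U) (laplacian U (zero_outside (pverts H) x)) (zero_outside (pverts H) x) = dot (pverts H) (laplacian H x) x"
proof -
  have GH: "zero_outside (pverts G) x v = 0" if "v \<in> pverts H" for v
    using that disjoint by (auto simp: zero_outside_def)
  have HG: "zero_outside (pverts H) x v = 0" if "v \<in> pverts G" for v
    using that disjoint by (auto simp: zero_outside_def)
  show "dot (pverts U) (laplacian U (zero_outside (pverts G) x)) (zero_outside (pverts G) x) = dot (pverts G) (laplacian G x) x"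
    unfolding dot_laplacian_union
    using dot_laplacian_cong[OF H, of "zero_outside (pverts G) x" "\<lambda>_. 0" "zero_outside (pverts G) x" "\<lambda>_. 0"] GH
      dot_laplacian_zero[OF H]
      dot_laplacian_cong[OF G, of "zero_outside (pverts G) x" x "zero_outside (pverts G) x" x]
    by (simp add: zero_outside_def)
  show "dot (pverts U) (laplacian U (zero_outside (pverts H) x)) (zero_outside (pverts H) x) = dot (pverts H) (laplacian H x) x"
    unfolding dot_laplacian_union
    using dot_laplacian_cong[OF G, of "zero_outside (pverts H) x" "\<lambda>_. 0" "zero_outside (pverts H) x" "\<lambda>_. 0"] HG
      dot_laplacian_zero[OF G]
      dot_laplacian_cong[OF H, of "zero_outside (pverts H) x" x "zero_outside (pverts H) x" x]
    by (simp add: zero_outside_def)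
qed

text \<open>Extension by zero makes the two families orthogonal and keeps their Rayleigh quotients.
  The set \<open>K\<close> and the threshold \<open>c\<close> are independent, since
  \<open>K\<close> will be chosen by the average degree of \<open>G\<close> while \<open>c\<close>
  is the average degree of the joined graph.\<close>

lemma ky_fan_union:
  assumes sdU: "spectral_decomposition (pverts U) (laplacian U) b \<mu> n"
    and sdG: "spectral_decomposition (pverts G) (laplacian G) b\<^sub>1 \<mu>\<^sub>1 n\<^sub>1"
    and K: "K \<subseteq> {..<n\<^sub>1}"
    and trial: "has_trial_family H k S"
  shows "(\<Sum>i\<in>K. \<mu>\<^sub>1 i - c) + (S - real k * c) \<le> (\<Sum>i<n. max 0 (\<mu> i - c))"
proof -
  interpret U: spectral_decomposition "pverts U" "laplacian U" b \<mu> n by (rule sdU)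
  interpret G: spectral_decomposition "pverts G" "laplacian G" b\<^sub>1 \<mu>\<^sub>1 n\<^sub>1 by (rule sdG)
  obtain f where f: "\<And>i. i < k \<Longrightarrow> dot (pverts H) (f i) (f i) > 0"
    "\<And>i j. i < k \<Longrightarrow> j < k \<Longrightarrow> i \<noteq> j \<Longrightarrow> dot (pverts H) (f i) (f j) = 0"
    "S \<le> (\<Sum>i<k. dot (pverts H) (laplacian H (f i)) (f i) / dot (pverts H) (f i) (f i))"
    using trial unfolding has_trial_family_def by blast
  define g where "g = case_sum (\<lambda>i. zero_outside (pverts G) (b\<^sub>1 i)) (\<lambda>i. zero_outside (pverts H) (f i))"
  define I where "I = K <+> {..<k}"
  have Kn: "\<And>i. i \<in> K \<Longrightarrow> i < n\<^sub>1" using K by auto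
  have finK: "finite K" using K by (rule finite_subset) simp
  have finI: "finite I" using finK by (simp add: I_def)
  have dotHG: "dot (pverts U) (zero_outside (pverts H) x) (zero_outside (pverts G) y) = 0" for x y
    using dot_zero_outside(3)[of y x] by (simp add: dot_commute)
  have "(\<Sum>i\<in>I. dot (pverts U) (laplacian U (g i)) (g i) / dot (pverts U) (g i) (g i) - c)
      \<le> (\<Sum>i<n. max 0 (\<mu> i - c))"
  proof (rule U.ky_fan_inequality[OF finI])
    fix i j assume "i \<in> I" "j \<in> I" "i \<noteq> j"
    then show "dot (pverts U) (g i) (g j) = 0"
      unfolding I_def
      by (elim PlusE) (simp_all add: g_def dot_zero_outside dotHG G.orthonormal Kn f(2))
  next
    fix i assume "i \<in> I"
    then show "0 < dot (pverts U) (g i) (g i)"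
      by (auto simp: I_def g_def dot_zero_outside G.orthonormal Kn f(1))
  qed
  also have "(\<Sum>i\<in>I. dot (pverts U) (laplacian U (g i)) (g i) / dot (pverts U) (g i) (g i) - c) =
      (\<Sum>i\<in>K. \<mu>\<^sub>1 i - c) +
      (\<Sum>i<k. dot (pverts H) (laplacian H (f i)) (f i) / dot (pverts H) (f i) (f i) - c)"
    unfolding I_def sum.Plus[OF finK finite_lessThan]
    by (simp add: g_def o_def dot_zero_outside dot_laplacian_zero_outside G.dot_L_eigenvector G.orthonormal Kn cong: sum.cong)
  finally show ?thesis using f(3) by (simp add: sum_subtractf)
qed

end

section \<open>Moments of the vector e_u - e_v\<close>

lemma laplacian_indicator:
  assumes G: "pair_graph G"
  shows "laplacian G (\<lambda>w. if w = u then 1 else 0) v =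
    (if v = u then real (card {w. (u, w) \<in> parcs G}) else if (u, v) \<in> parcs G then - 1 else 0)"
proof (cases "v = u")
  case True
  have "laplacian G (\<lambda>w. if w = u then 1 else 0) u = (\<Sum>w | (u, w) \<in> parcs G. 1)"
    unfolding laplacian_def using parcs_irrefl[OF G] by (intro sum.cong) auto
  with True show ?thesis by simp
next
  case False
  have "laplacian G (\<lambda>w. if w = u then 1 else 0) v = (\<Sum>w | (v, w) \<in> parcs G. if w = u then - 1 else 0)"
    unfolding laplacian_def using False by (intro sum.cong) auto
  also have "\<dots> = (if (u, v) \<in> parcs G then - 1 else 0)"
    using finite_neighbours[OF G, of v] parcs_sym[OF G] by (auto simp: sum.delta)
  finally show ?thesis using False by simp
qed

text \<open>The Laplacian of the indicator of \<open>u\<close> has the entry d at \<open>u\<close>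
  and -1 at each of its d neighbours.\<close>

lemma dot_laplacian_indicator:
  assumes G: "pair_graph G" and u: "u \<in> pverts G"
  defines "e \<equiv> \<lambda>w. if w = u then 1 else 0" and "d \<equiv> real (card {w. (u, w) \<in> parcs G})"
  shows "dot (pverts G) (laplacian G e) e = d"
    and "dot (pverts G) (laplacian G e) (laplacian G e) = d\<^sup>2 + d"
proof -
  have fin: "finite (pverts G)" by (rule finite_pverts[OF G])
  have "dot (pverts G) (laplacian G e) e = (\<Sum>v\<in>pverts G. if v = u then d else 0)"
    unfolding dot_def e_def laplacian_indicator[OF G] d_def by (intro sum.cong) auto
  then show "dot (pverts G) (laplacian G e) e = d"
    using fin u by simp
  have N: "{w. (u, w) \<in> parcs G} = {w \<in> pverts G - {u}. (u, w) \<in> parcs G}"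
    using parcs_in_pverts[OF G] parcs_irrefl[OF G] by auto
  have "dot (pverts G) (laplacian G e) (laplacian G e) =
      d\<^sup>2 + (\<Sum>v\<in>pverts G - {u}. laplacian G e v * laplacian G e v)"
    unfolding dot_def using fin u
    by (subst sum.remove[of _ u]) (simp_all add: e_def laplacian_indicator[OF G] d_def power2_eq_square)
  also have "(\<Sum>v\<in>pverts G - {u}. laplacian G e v * laplacian G e v) =
      (\<Sum>v\<in>pverts G - {u}. if (u, v) \<in> parcs G then 1 else 0)"
    unfolding e_def laplacian_indicator[OF G] by (intro sum.cong refl) auto
  also have "\<dots> = real (card {w \<in> pverts G - {u}. (u, w) \<in> parcs G})"
    using fin by (simp add: sum.If_cases Int_def)
  also have "\<dots> = d" unfolding N[symmetric] d_def ..
  finally show "dot (pverts G) (laplacian G e) (laplacian G e) = d\<^sup>2 + d" .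
qed

context two_graphs
begin

lemma laplacian_join:
  assumes u: "u \<in> pverts G" and v: "v \<in> pverts H" and J: "pair_graph (join_by_edge G H u v)"
  shows "dot (pverts U) (laplacian (join_by_edge G H u v) y) y =
    dot (pverts U) (laplacian U y) y + (y u - y v)\<^sup>2"
proof -
  let ?J = "join_by_edge G H u v"
  have V: "pverts U = pverts ?J" by (simp add: disjoint_union_def join_by_edge_def)
  have uv: "u \<noteq> v" using u v disjoint by blast
  have parcs: "parcs ?J = parcs U \<union> {(u, v), (v, u)}" "parcs U \<inter> {(u, v), (v, u)} = {}"
  proof -
    have "v \<notin> pverts G" "u \<notin> pverts H" using u v disjoint by auto
    then have "(u, v) \<notin> parcs G" "(v, u) \<notin> parcs G" "(u, v) \<notin> parcs H" "(v, u) \<notin> parcs H"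
      using parcs_in_pverts[OF G] parcs_in_pverts[OF H] by blast+
    then show "parcs ?J = parcs U \<union> {(u, v), (v, u)}" "parcs U \<inter> {(u, v), (v, u)} = {}"
      by (auto simp: disjoint_union_def join_by_edge_def)
  qed
  have "dot (pverts ?J) (laplacian ?J y) y =
      ((\<Sum>(v, w)\<in>parcs U. (y v - y w) * (y v - y w)) + 2 * (y u - y v)\<^sup>2) / 2"
    unfolding dot_laplacian[OF J] parcs(1) using uv finite_parcs[OF U] parcs(2)
    by (subst sum.union_disjoint) (auto simp: power2_eq_square algebra_simps)
  then show ?thesis
    unfolding V[symmetric] dot_laplacian[OF U] by (simp add: add_divide_distrib)
qed

text \<open>The vertices \<open>u\<close> and \<open>v\<close> lie in different components of the
  union, so no mixed terms arise and the moments of the two indicators add up.\<close>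

lemma moments_of_joining_vector:
  assumes u: "u \<in> pverts G" and v: "v \<in> pverts H"
  defines "z \<equiv> \<lambda>w. (if w = u then 1 else 0) - (if w = v then 1 else (0 :: real))"
    and "d \<equiv> real (card {w. (u, w) \<in> parcs G})" and "d' \<equiv> real (card {w. (v, w) \<in> parcs H})"
  shows "dot (pverts U) z y = y u - y v"
    and "dot (pverts U) (laplacian U z) z = d + d'"
    and "dot (pverts U) (laplacian U z) (laplacian U z) = d\<^sup>2 + d + d'\<^sup>2 + d'"
proof -
  let ?e = "\<lambda>u w. if w = u then 1 else (0 :: real)"
  have uH: "u \<notin> pverts H" and vG: "v \<notin> pverts G" using u v disjoint by auto
  have finU: "finite (pverts U)" by (rule finite_pverts[OF U])
  have uvU: "u \<in> pverts U" "v \<in> pverts U" using u v by (simp_all add: disjoint_union_def)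
  have "dot (pverts U) z y = (\<Sum>w\<in>pverts U. if w = u then y u else 0) - (\<Sum>w\<in>pverts U. if w = v then y v else 0)"
    unfolding dot_def z_def sum_subtractf[symmetric] by (intro sum.cong refl) auto
  then show "dot (pverts U) z y = y u - y v" using finU uvU by simp
  have zG: "z w = ?e u w" if "w \<in> pverts G" for w using that vG by (auto simp: z_def)
  have zH: "z w = - ?e v w" if "w \<in> pverts H" for w using that uH by (auto simp: z_def)
  have neg: "laplacian H (\<lambda>w. - ?e v w) = (\<lambda>w. - laplacian H (?e v) w)"
    by (auto simp: laplacian_def sum_negf[symmetric] intro!: sum.cong)
  have dot_neg: "dot V (\<lambda>w. - x w) (\<lambda>w. - y w) = dot V x y" for V and x y :: "'a \<Rightarrow> real"
    by (simp add: dot_def)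
  have "dot (pverts G) (laplacian G z) z = d"
    using dot_laplacian_cong[OF G, of z "?e u" z "?e u"] zG dot_laplacian_indicator(1)[OF G u] by (simp add: d_def)
  moreover have "dot (pverts H) (laplacian H z) z = d'"
    using dot_laplacian_cong[OF H, of z "\<lambda>w. - ?e v w" z "\<lambda>w. - ?e v w"] zH
      dot_laplacian_indicator(1)[OF H v]
    unfolding neg dot_neg by (simp add: d'_def)
  ultimately show "dot (pverts U) (laplacian U z) z = d + d'"
    unfolding dot_laplacian_union by simp
  have NG: "laplacian U z w = laplacian G (?e u) w" if w: "w \<in> pverts G" for w
  proof -
    have "{y. (w, y) \<in> parcs U} = {y. (w, y) \<in> parcs G}"
      using w disjoint parcs_in_pverts[OF H] by (auto simp: disjoint_union_def)
    then show ?thesis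
      unfolding laplacian_def using zG w parcs_in_pverts[OF G] by (intro sum.cong) auto
  qed
  have NH: "laplacian U z w = - laplacian H (?e v) w" if w: "w \<in> pverts H" for w
  proof -
    have "{y. (w, y) \<in> parcs U} = {y. (w, y) \<in> parcs H}"
      using w disjoint parcs_in_pverts[OF G] by (auto simp: disjoint_union_def)
    then show ?thesis
      unfolding laplacian_def sum_negf[symmetric] using zH w parcs_in_pverts[OF H] by (intro sum.cong) auto
  qed
  have "dot (pverts G) (laplacian U z) (laplacian U z) = d\<^sup>2 + d"
    using dot_cong[of "pverts G" "laplacian U z" "laplacian G (?e u)" "laplacian U z" "laplacian G (?e u)"] NG dot_laplacian_indicator(2)[OF G u] by (simp add: d_def)
  moreover have "dot (pverts H) (laplacian U z) (laplacian U z) = d'\<^sup>2 + d'"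
    using dot_cong[of "pverts H" "laplacian U z" "\<lambda>w. - laplacian H (?e v) w" "laplacian U z" "\<lambda>w. - laplacian H (?e v) w"] NH dot_laplacian_indicator(2)[OF H v]
    unfolding dot_neg by (simp add: d'_def)
  ultimately show "dot (pverts U) (laplacian U z) (laplacian U z) = d\<^sup>2 + d + d'\<^sup>2 + d'"
    unfolding dot_union by simp
qed

text \<open>A neighbour at each end makes both degrees at least 1, which is what keeps the variance
  in the moment bound at most the square of the mean.\<close>

lemma join_energy_gain:
  assumes u: "u \<in> pverts G" and v: "v \<in> pverts H" and J: "pair_graph (join_by_edge G H u v)"
    and sdU: "spectral_decomposition (pverts U) (laplacian U) b \<mu> n"
    and sdJ: "spectral_decomposition (pverts U) (laplacian (join_by_edge G H u v)) b' \<mu>' n'"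
    and deg: "\<exists>w. (u, w) \<in> parcs G" "\<exists>w. (v, w) \<in> parcs H"
    and x: "0 \<le> x" "x \<le> 6 / 100"
  shows "(\<Sum>k<n. max 0 (\<mu> k - (2 - 2 * x))) + 45 / 100 + x \<le> (\<Sum>k<n'. max 0 (\<mu>' k - (2 - 2 * x)))"
proof -
  have uv: "u \<noteq> v" using u v disjoint by blast
  have "1 \<le> card {w. (u, w) \<in> parcs G}" "1 \<le> card {w. (v, w) \<in> parcs H}"
    using deg finite_neighbours[OF G] finite_neighbours[OF H] by (auto simp: Suc_le_eq card_gt_0_iff)
  note deg1 = this[folded of_nat_le_iff[where 'a = real], unfolded of_nat_1]
  note mom = moments_of_joining_vector[OF u v]
  show ?thesis
    using deg1 x uv mom(1) laplacian_join[OF u v J]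
    by (intro rank_one_perturbation_gain[OF sdU sdJ _ _ mom(2,3)]) (simp_all add: mom(1))
qed

end

section \<open>Decimal bounds for pi\<close>

lemma sin_polynomial_bounds:
  fixes y :: real
  assumes "\<bar>y\<bar> \<le> 1"
  shows "\<bar>sin y - (y - y ^ 3 / 6 + y ^ 5 / 120 - y ^ 7 / 5040)\<bar> \<le> \<bar>y\<bar> ^ 9 / 362880"
proof -
  have "(\<Sum>m<9. sin_coeff m * y ^ m) = y - y ^ 3 / 6 + y ^ 5 / 120 - y ^ 7 / 5040"
  proof -
    have "{..<9 :: nat} = {0, 1, 2, 3, 4, 5, 6, 7, 8}" by auto
    then show ?thesis by (simp add: sin_coeff_def fact_numeral)
  qed
  then show ?thesis
    using Maclaurin_sin_bound[of y 9] by (simp add: fact_numeral inverse_eq_divide)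
qed

text \<open>As sin (pi / 6) = 1/2 and the sine increases there, comparing pi with a decimal amounts
  to comparing a Taylor polynomial at one sixth of that decimal with 1/2. Four decimals give 2/pi to
  the accuracy needed for the final estimate.\<close>

lemma pi_bounds: "31415 / 10000 \<le> pi" "pi \<le> 31416 / 10000"
proof -
  have s: "sin (pi / 6) = 1 / 2" by (rule sin_30)
  show "31415 / 10000 \<le> pi"
  proof (rule ccontr)
    assume "\<not> 31415 / 10000 \<le> pi"
    then have "sin (pi / 6) < sin (31415 / 60000)"
      using pi_ge_two by (intro sin_monotone_2pi) auto
    then show False
      using sin_polynomial_bounds[of "31415 / 60000"] s by (simp add: power_divide abs_if split: if_splits)
  qed
  show "pi \<le> 31416 / 10000"
  proof (rule ccontr)
    assume "\<not> pi \<le> 31416 / 10000"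
    then have "sin (31416 / 60000) < sin (pi / 6)"
      using pi_ge_two by (intro sin_monotone_2pi) auto
    then show False
      using sin_polynomial_bounds[of "31416 / 60000"] s by (simp add: power_divide abs_if split: if_splits)
  qed
qed

section \<open>The energy of a path\<close>

text \<open>If \<open>\<nu>\<close> differed from all \<open>\<mu> k\<close>, self-adjointness would
  make \<open>x\<close> orthogonal to every \<open>b k\<close> and hence zero on
  \<open>V\<close>.\<close>

lemma (in spectral_decomposition) eigenvalue_mem:
  assumes x: "\<And>v. v \<in> V \<Longrightarrow> L x v = \<nu> * x v" and v: "v \<in> V" "x v \<noteq> 0"
  shows "\<nu> \<in> \<mu> ` {..<n}"
proof (rule ccontr)
  assume neg: "\<nu> \<notin> \<mu> ` {..<n}"
  have "dot V x (b k) = 0" if k: "k < n" for k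
  proof -
    have "\<mu> k * dot V x (b k) = dot V (\<lambda>v. \<nu> * x v) (b k)"
      unfolding dot_L_eigenvector[OF k, symmetric] by (rule dot_cong) (simp_all add: x)
    then have "(\<mu> k - \<nu>) * dot V x (b k) = 0" by (simp add: dot_scale_left algebra_simps)
    then show ?thesis using neg k by auto
  qed
  then have "dot V x x = 0" by (simp add: dot_self[of x])
  then have "x v * x v = 0"
    using finite_V v(1) unfolding dot_def by (simp add: sum_nonneg_eq_0_iff)
  then show False using v(2) by simp
qed

lemma pair_graph_path: "pair_graph (path_graph n)"
  by (rule pair_graphI) (auto simp: path_graph_def)

lemma average_degree_path:
  assumes "n \<ge> 1"
  shows "average_degree (path_graph n) = 2 - 2 / real n"
proof -
  have "graph_edges (path_graph n) = (\<lambda>i. {i, Suc i}) ` {..<n - 1}"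
  proof (intro equalityI subsetI)
    fix e assume "e \<in> (\<lambda>i. {i, Suc i}) ` {..<n - 1}"
    then obtain i where "i < n - 1" "e = {i, Suc i}" by blast
    then show "e \<in> graph_edges (path_graph n)"
      unfolding graph_edges_def path_graph_def
      by (intro CollectI exI[of _ i] exI[of _ "Suc i"]) auto
  qed (auto simp: graph_edges_def path_graph_def)
  moreover have "inj_on (\<lambda>i. {i, Suc i}) {..<n - 1}"
    by (auto simp: inj_on_def doubleton_eq_iff)
  ultimately have "card (graph_edges (path_graph n)) = n - 1"
    by (simp add: card_image)
  then show ?thesis
    using assms by (simp add: average_degree_def path_graph_def of_nat_diff field_simps)
qed

lemma laplacian_path:
  assumes j: "j < n"
  shows "laplacian (path_graph n) x j =
    (if j = 0 then 0 else x j - x (j - 1)) + (if Suc j = n then 0 else x j - x (Suc j))"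
proof -
  have "{w. (j, w) \<in> parcs (path_graph n)} =
      (if j = 0 then {} else {j - 1}) \<union> (if Suc j = n then {} else {Suc j})"
    using j by (auto simp: path_graph_def)
  then show ?thesis unfolding laplacian_def by auto
qed

text \<open>The shift by 1/2 makes the cosine symmetric about the points midway between -1 and 0 and
  between n - 1 and n. So its values at the fictitious vertices -1 and n equal those at their
  neighbours, and the two end vertices satisfy the same recurrence as the inner ones.\<close>

lemma path_eigenvector:
  fixes j k n :: nat
  assumes j: "j < n"
  defines "\<theta> \<equiv> pi * real k / real n"
  shows "laplacian (path_graph n) (\<lambda>j. cos (\<theta> * (real j + 1 / 2))) j =
    (2 - 2 * cos \<theta>) * cos (\<theta> * (real j + 1 / 2))"
proof -
  define W where "W t = cos (\<theta> * (t + 1 / 2))" for t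
  have left: "(if j = 0 then 0 else W (real j) - W (real (j - 1))) = W (real j) - W (real j - 1)"
  proof (cases "j = 0")
    case True
    have "\<theta> * (- 1 + 1 / 2) = - (\<theta> * (0 + 1 / 2))" by simp
    then have "W (- 1) = W 0" unfolding W_def by (metis cos_minus)
    with True show ?thesis by simp
  qed (simp add: of_nat_diff)
  have right: "(if Suc j = n then 0 else W (real j) - W (real (Suc j))) = W (real j) - W (real j + 1)"
  proof (cases "Suc j = n")
    case True
    then have n: "real n = real j + 1" by simp
    have "\<theta> * real n = pi * real k" using j by (simp add: \<theta>_def)
    then have "\<theta> * (real j + 1 / 2) = pi * real k - \<theta> / 2" "\<theta> * (real j + 1 + 1 / 2) = pi * real k + \<theta> / 2"
      unfolding n by (simp_all add: algebra_simps)
    then have "W (real j) = W (real j + 1)"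
      by (simp add: W_def cos_add cos_diff sin_npi2)
    with True show ?thesis by simp
  qed (simp add: add.commute)
  have "W (real j - 1) + W (real j + 1) = 2 * cos \<theta> * W (real j)"
  proof -
    have "\<theta> * (real j - 1 + 1 / 2) = \<theta> * (real j + 1 / 2) - \<theta>"
      "\<theta> * (real j + 1 + 1 / 2) = \<theta> * (real j + 1 / 2) + \<theta>"
      by (simp_all add: algebra_simps)
    then show ?thesis by (simp add: W_def cos_add cos_diff)
  qed
  then have "laplacian (path_graph n) (\<lambda>j. W (real j)) j = (2 - 2 * cos \<theta>) * W (real j)"
    unfolding laplacian_path[OF j, of "\<lambda>j. W (real j)"] left right by (simp add: algebra_simps)
  then show ?thesis unfolding W_def .
qed

text \<open>The sum telescopes through 2 sin h cos (2hk) = sin ((2k + 1) h) - sin ((2k - 1) h); the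
  last summand on the right is the boundary term at k = 0.\<close>

lemma dirichlet_kernel:
  "sin h * (\<Sum>k<m. 2 * cos (2 * h * real k)) = sin ((2 * real m - 1) * h) + sin h"
proof (induction m)
  case (Suc m)
  have "(2 * real (Suc m) - 1) * h = 2 * h * real m + h" "(2 * real m - 1) * h = 2 * h * real m - h"
    by (simp_all add: algebra_simps)
  then show ?case
    using Suc by (simp add: sin_add sin_diff algebra_simps)
qed simp

text \<open>The cubic Taylor bound for the sine is enough here. The error h will be pi / (2n), small
  enough to be absorbed by a term 2/n.\<close>

lemma inverse_sin_le:
  fixes h :: real
  assumes "0 < h" "h \<le> 1"
  shows "1 / sin h \<le> 1 / h + h"
proof -
  have "{..<3 :: nat} = {0, 1, 2}" by auto
  then have "\<bar>sin h - h\<bar> \<le> h ^ 3 / 6"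
    using Maclaurin_sin_bound[of h 3] assms by (simp add: sin_coeff_def fact_numeral inverse_eq_divide)
  then have "- (sin h - h) \<le> h ^ 3 / 6" by (rule abs_le_D2)
  then have s: "h - h ^ 3 / 6 \<le> sin h" by linarith
  have h2: "h\<^sup>2 \<le> 1" using assms by (simp add: power_le_one)
  have "h ^ 3 \<le> h" using h2 assms by (simp add: power3_eq_cube power2_eq_square mult_left_le_one_le)
  then have pos: "0 < sin h" using s assms by linarith
  have "0 \<le> h ^ 3 * (5 - h\<^sup>2)" using h2 assms by simp
  also have "\<dots> = 6 * ((h - h ^ 3 / 6) * (1 + h\<^sup>2) - h)"
    by (simp add: power2_eq_square power3_eq_cube algebra_simps)
  finally have "h \<le> (h - h ^ 3 / 6) * (1 + h\<^sup>2)" by simp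
  also have "\<dots> \<le> sin h * (1 + h\<^sup>2)" using s by (intro mult_right_mono) auto
  finally show ?thesis using pos assms by (simp add: field_simps power2_eq_square)
qed

text \<open>This replaces the positive parts by a prefix sum without determining its length, which
  for the path depends on n. The bound \<open>1 \<le> m\<close> is used in the estimate of the path
  energy.\<close>

lemma sum_max_0_antimono:
  fixes a :: "nat \<Rightarrow> real"
  assumes anti: "\<And>i j. i \<le> j \<Longrightarrow> j < n \<Longrightarrow> a j \<le> a i" and "0 < n" "0 \<le> a 0"
  obtains m where "1 \<le> m" "m \<le> n" "(\<Sum>k<n. max 0 (a k)) = (\<Sum>k<m. a k)"
proof -
  define m where "m = (LEAST k. k = n \<or> a k < 0)"
  have m: "m = n \<or> a m < 0" unfolding m_def by (rule LeastI[of _ n]) simp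
  have "m \<le> n" unfolding m_def by (rule Least_le) simp
  have small: "0 \<le> a k" if "k < m" for k
    using not_less_Least[OF that[unfolded m_def]] by auto
  have "m \<noteq> 0" using m assms(2,3) by (cases "m = 0") auto
  have "max 0 (a k) = 0" if "k \<in> {..<n} - {..<m}" for k
    using that m anti[of m k] by auto
  then have "(\<Sum>k<n. max 0 (a k)) = (\<Sum>k<m. max 0 (a k))"
    using \<open>m \<le> n\<close> by (intro sum.mono_neutral_right) auto
  also have "\<dots> = (\<Sum>k<m. a k)" using small by (intro sum.cong) auto
  finally show ?thesis using \<open>m \<noteq> 0\<close> \<open>m \<le> n\<close> by (intro that[of m]) simp_all
qed

text \<open>The n numbers \<open>\<nu> k\<close> are eigenvalues and pairwise distinct, so they
  exhaust the spectrum and all multiplicities are 1. The energy then becomes a partial sum of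
  cosines, bounded by replacing the sine in the numerator of the Dirichlet kernel by 1.\<close>

theorem path_energy_le:
  assumes n: "n \<ge> 2"
  shows "laplacian_energy (path_graph n) \<le> 4 * real n / pi + 2"
proof -
  let ?G = "path_graph n" and ?c = "2 - 2 / real n"
  define \<theta> where "\<theta> k = pi * real k / real n" for k
  define \<nu> where "\<nu> k = 2 - 2 * cos (\<theta> k)" for k
  have V: "pverts ?G = {..<n}" by (simp add: path_graph_def)
  obtain b \<mu> where sd: "spectral_decomposition (pverts ?G) (laplacian ?G) b \<mu> (card (pverts ?G))"
    and ev: "laplacian_eigenvalues ?G = mset (map \<mu> [0..<card (pverts ?G)])"
    using laplacian_spectral_decomposition[OF pair_graph_path] by blast
  have card: "card (pverts ?G) = n" by (simp add: V)
  interpret spectral_decomposition "pverts ?G" "laplacian ?G" b \<mu> n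
    using sd unfolding card .
  have ne: "pverts ?G \<noteq> {}" using n by (simp add: V lessThan_empty_iff)
  have avg: "average_degree ?G = ?c" using average_degree_path n by simp
  have LE: "laplacian_energy ?G = 2 * (\<Sum>k<n. max 0 (\<mu> k - ?c))" and zero: "(\<Sum>k<n. \<mu> k - ?c) = 0"
    using laplacian_energy_eq[OF pair_graph_path ne sd ev] unfolding avg card by simp_all
  have \<theta>: "0 \<le> \<theta> k \<and> \<theta> k \<le> pi" if "k < n" for k
    using that by (auto simp: \<theta>_def field_simps)
  have \<theta>_less: "\<theta> j < \<theta> k" if "j < k" for j k
    using that n by (simp add: \<theta>_def divide_strict_right_mono)
  have cos_less: "cos (\<theta> k) < cos (\<theta> j)" if "j < k" "k < n" for j k
    using \<theta>_less[OF that(1)] \<theta>[of k] \<theta>[of j] that by (intro cos_monotone_0_pi) auto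
  have inj: "inj_on \<nu> {..<n}"
    by (rule linorder_inj_onI) (use cos_less in \<open>fastforce simp: \<nu>_def\<close>)+
  have "\<nu> k \<in> \<mu> ` {..<n}" if k: "k < n" for k
  proof (rule eigenvalue_mem)
    show "laplacian ?G (\<lambda>j. cos (\<theta> k * (real j + 1 / 2))) j = \<nu> k * cos (\<theta> k * (real j + 1 / 2))"
      if "j \<in> pverts ?G" for j
      using path_eigenvector[of j n k] that by (simp add: V \<nu>_def \<theta>_def)
    show "0 \<in> pverts ?G" using n by (simp add: V)
    have "\<theta> k < pi" using k by (simp add: \<theta>_def field_simps)
    then have "0 < cos (\<theta> k / 2)" using \<theta>[OF k] by (intro cos_gt_zero_pi) auto
    then show "cos (\<theta> k * (real 0 + 1 / 2)) \<noteq> 0" by simp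
  qed
  then have sub: "\<nu> ` {..<n} \<subseteq> \<mu> ` {..<n}" by auto
  have card\<nu>: "card (\<nu> ` {..<n}) = n" using card_image[OF inj] by simp
  have "card (\<mu> ` {..<n}) \<le> n" using card_image_le[of "{..<n}" \<mu>] by simp
  then have eq: "\<nu> ` {..<n} = \<mu> ` {..<n}"
    using sub card\<nu> by (intro card_seteq) auto
  then have inj\<mu>: "inj_on \<mu> {..<n}"
    using card\<nu> by (intro eq_card_imp_inj_on) auto
  \<comment> \<open>As the deviations sum to zero, the energy is also twice the total deficiency
    below the average. The eigenvalues concerned are those with small index k, so a prefix sum of
    cosines results.\<close>
  have "laplacian_energy ?G = 2 * (\<Sum>k<n. max 0 (?c - \<mu> k) + (\<mu> k - ?c))"
    unfolding LE by (intro arg_cong[of _ _ "\<lambda>x. 2 * x"] sum.cong refl) (simp add: max_def)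
  also have "\<dots> = 2 * (\<Sum>k<n. max 0 (?c - \<mu> k))"
    unfolding sum.distrib zero by simp
  also have "(\<Sum>k<n. max 0 (?c - \<mu> k)) = (\<Sum>y\<in>\<mu> ` {..<n}. max 0 (?c - y))"
    by (subst sum.reindex[OF inj\<mu>]) simp
  also have "\<dots> = (\<Sum>k<n. max 0 (?c - \<nu> k))"
    unfolding eq[symmetric] by (subst sum.reindex[OF inj]) simp
  finally have LE': "laplacian_energy ?G = 2 * (\<Sum>k<n. max 0 (?c - \<nu> k))" .
  have anti: "?c - \<nu> j \<le> ?c - \<nu> i" if "i \<le> j" "j < n" for i j
    using that cos_less[of i j] by (cases "i = j") (auto simp: \<nu>_def)
  have a0: "0 \<le> ?c - \<nu> 0" using n by (simp add: \<nu>_def \<theta>_def field_simps)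
  have "\<exists>m\<ge>1. (\<Sum>k<n. max 0 (?c - \<nu> k)) = (\<Sum>k<m. ?c - \<nu> k)"
  proof (rule sum_max_0_antimono[of n "\<lambda>k. ?c - \<nu> k"])
    show "?c - \<nu> j \<le> ?c - \<nu> i" if "i \<le> j" "j < n" for i j by (rule anti[OF that])
    show "0 < n" using n by simp
    show "\<exists>m\<ge>1. (\<Sum>k<n. max 0 (?c - \<nu> k)) = (\<Sum>k<m. ?c - \<nu> k)"
      if "1 \<le> m" "(\<Sum>k<n. max 0 (?c - \<nu> k)) = (\<Sum>k<m. ?c - \<nu> k)" for m
      using that by blast
  qed (rule a0)
  then obtain m where m: "1 \<le> m" "(\<Sum>k<n. max 0 (?c - \<nu> k)) = (\<Sum>k<m. ?c - \<nu> k)"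
    by blast
  define h where "h = pi / (2 * real n)"
  have h: "0 < h" "h \<le> 1"
    using n pi_less_4 by (auto simp: h_def field_simps)
  have sh: "0 < sin h" using h pi_ge_two by (intro sin_gt_zero) auto
  have sum: "(\<Sum>k<m. ?c - \<nu> k) = (\<Sum>k<m. 2 * cos (2 * h * real k)) - real m * (2 / real n)"
    by (simp add: \<nu>_def \<theta>_def h_def sum_subtractf)
  have "(\<Sum>k<m. 2 * cos (2 * h * real k)) = (sin ((2 * real m - 1) * h) + sin h) / sin h"
    using dirichlet_kernel[of h m] sh by (simp add: field_simps)
  also have "\<dots> \<le> (1 + sin h) / sin h"
    using sh by (intro divide_right_mono) auto
  also have "\<dots> = 1 / sin h + 1" using sh by (simp add: field_simps)
  also have "1 / sin h \<le> 1 / h + h" by (rule inverse_sin_le[OF h])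
  also have "1 / h = 2 * real n / pi" by (simp add: h_def)
  also have "h \<le> 2 / real n" using pi_less_4 n by (simp add: h_def field_simps)
  finally have "(\<Sum>k<m. 2 * cos (2 * h * real k)) \<le> 2 * real n / pi + 2 / real n + 1" by simp
  \<comment> \<open>The correction 2/n of the average degree is subtracted m times; a single one
    already cancels the error 2/n from the sine.\<close>
  moreover have "1 * (2 / real n) \<le> real m * (2 / real n)" using m(1) by (intro mult_right_mono) auto
  ultimately have "(\<Sum>k<m. ?c - \<nu> k) \<le> 2 * real n / pi + 1" unfolding sum by simp
  then show ?thesis unfolding LE' m(2) by simp
qed

section \<open>The energy of the joined tree\<close>

lemma laplacian_eigenvalue_nonneg:
  assumes G: "pair_graph G" and sd: "spectral_decomposition (pverts G) (laplacian G) b \<mu> n" and k: "k < n"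
  shows "0 \<le> \<mu> k"
proof -
  interpret spectral_decomposition "pverts G" "laplacian G" b \<mu> n by (rule sd)
  have "\<mu> k = dot (pverts G) (laplacian G (b k)) (b k)"
    by (simp add: dot_L_eigenvector k orthonormal)
  also have "\<dots> \<ge> 0" unfolding dot_laplacian[OF G] by (simp add: sum_nonneg case_prod_unfold)
  finally show ?thesis .
qed

text \<open>Here \<open>P\<close> stands for 2/pi and \<sigma> for the number of eigenvalues of the
  first tree at least its average degree. The left side is the share still to be paid plus the loss
  from changing the threshold; the right side is what the trial vectors and the new edge bring
  in.\<close>

lemma numerical_estimate:
  fixes n\<^sub>1 n\<^sub>2 k :: nat and P S \<sigma> :: real
  defines "n \<equiv> n\<^sub>1 + n\<^sub>2"
  assumes n: "6 \<le> n\<^sub>2" "n\<^sub>2 \<le> n\<^sub>1" "19 \<le> n"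
    and P: "63661 / 100000 \<le> P" "P \<le> 63664 / 100000"
    and \<sigma>: "1 + P * real n\<^sub>1 \<le> (real n\<^sub>1 - \<sigma>) * (2 - 2 / real n\<^sub>1)"
    and S: "k = 1 \<and> S = real n\<^sub>2 \<or>
      k = 2 \<and> S = real n\<^sub>2 + 2 - (if n\<^sub>2 = 6 then 49 / 100 else if n\<^sub>2 = 7 then 7 / 10 else 1)"
  shows "P * real n\<^sub>2 + \<sigma> * (2 / real n\<^sub>1 - 2 / real n) \<le>
    S - real k * (2 - 2 / real n) + 45 / 100 + 1 / real n"
proof -
  \<comment> \<open>In terms of t the hypothesis on \<sigma> bounds (2 - t) (n1 - 1) from below, so
    t is less than 136339/100000 = 2 - 63661/100000, and the loss is t n2 / n.\<close>
  define t where "t = 2 * \<sigma> / real n\<^sub>1"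
  have n1: "real n\<^sub>1 \<ge> 6" and n2: "real n\<^sub>2 \<ge> 6" and n19: "real n \<ge> 19"
    using n by simp_all
  have nn: "real n = real n\<^sub>1 + real n\<^sub>2" by (simp add: n_def)
  have "(real n\<^sub>1 - \<sigma>) * (2 - 2 / real n\<^sub>1) = (2 - t) * (real n\<^sub>1 - 1)"
    using n1 by (simp add: t_def field_simps)
  moreover have "P * real n\<^sub>1 \<ge> 63661 / 100000 * real n\<^sub>1" using P(1) by (intro mult_right_mono) auto
  moreover have "(136339 / 100000 - t) * (real n\<^sub>1 - 1) =
      (2 - t) * (real n\<^sub>1 - 1) - 63661 / 100000 * real n\<^sub>1 + 63661 / 100000"
    by (simp add: field_simps)
  ultimately have t: "163661 / 100000 \<le> (136339 / 100000 - t) * (real n\<^sub>1 - 1)"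
    using \<sigma> by linarith
  then have "0 < (136339 / 100000 - t) * (real n\<^sub>1 - 1)" by simp
  then have t1: "t < 136339 / 100000" using n1 by (simp add: zero_less_mult_iff)
  have tn2: "t * real n\<^sub>2 \<le> 136339 / 100000 * real n\<^sub>2" using t1 by (intro mult_right_mono) auto
  have Pn2: "P * real n\<^sub>2 \<le> 63664 / 100000 * real n\<^sub>2" using P(2) by (intro mult_right_mono) auto
  have sig: "\<sigma> * (2 / real n\<^sub>1 - 2 / real n) = t * real n\<^sub>2 / real n"
    using n1 n2 unfolding t_def nn by (simp add: field_simps)
  have main: "0 \<le> real n * (S - 2 * real k + 45 / 100 - 63664 / 100000 * real n\<^sub>2) + 2 * real k + 1 - t * real n\<^sub>2"
    using S
  proof (elim disjE conjE)
    assume k: "k = 1" "S = real n\<^sub>2"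
    \<comment> \<open>The coefficient of n is positive for n2 at least 6, so n = 19 is the worst
      case, and the rest is linear in n2.\<close>
    have "19 * (36336 / 100000 * real n\<^sub>2 - 155 / 100) \<le> real n * (36336 / 100000 * real n\<^sub>2 - 155 / 100)"
      using n19 n2 by (intro mult_right_mono) auto
    moreover have inner: "S - 2 * real k + 45 / 100 - 63664 / 100000 * real n\<^sub>2 = 36336 / 100000 * real n\<^sub>2 - 155 / 100"
      using k by simp
    moreover have "0 \<le> 19 * (36336 / 100000 * real n\<^sub>2 - 155 / 100) + 2 * 1 + 1 - t * real n\<^sub>2"
    proof -
      have "0 \<le> 19 * (36336 / 100000 * N - 155 / 100) + 2 * 1 + 1 - w"
        if "6 \<le> N" "w \<le> 136339 / 100000 * N" for N w :: real using that by simp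
      then show ?thesis using n2 tn2 by blast
    qed
    ultimately show ?thesis unfolding inner unfolding k(1) of_nat_1 by (meson add_right_mono diff_right_mono order_trans)
  next
    assume k: "k = 2"
      "S = real n\<^sub>2 + 2 - (if n\<^sub>2 = 6 then 49 / 100 else if n\<^sub>2 = 7 then 7 / 10 else 1)"
    consider "n\<^sub>2 = 6" | "n\<^sub>2 = 7" | "n\<^sub>2 \<ge> 8" using n(1) by linarith
    then show ?thesis
    proof cases
      case 1
      \<comment> \<open>The tightest case: the bound on t alone fails at n = 19. The full inequality
        for t, multiplied by 6, leaves a quadratic in y = n1 - 1 = n - 7 with minimum near 7.85, and
        completing the square there shows that it is positive.\<close>
      define y where "y = real n\<^sub>1 - 1"
      have y: "y \<ge> 12" using n19 nn 1 by (simp add: y_def)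
      have "6 * (163661 / 100000) \<le> 6 * ((136339 / 100000 - t) * y)"
        unfolding y_def by (intro mult_left_mono t) simp
      moreover have "(14016 / 100000 * (y + 7) + 5 - 6 * t) * y =
          (6 * ((136339 / 100000 - t) * y) - 6 * (163661 / 100000)) + 14 / 100 * (y - 785 / 100)\<^sup>2
          + 16 / 100000 * (y * (y - 12)) + 7 / 10000 * y + 119251 / 100000"
        by (simp add: power2_eq_square field_simps)
      moreover have "0 \<le> y * (y - 12)" using y by simp
      moreover have "0 \<le> (y - 785 / 100)\<^sup>2" by simp
      ultimately have "0 \<le> (14016 / 100000 * (y + 7) + 5 - 6 * t) * y"
        using y by linarith
      then have "0 \<le> 14016 / 100000 * (y + 7) + 5 - 6 * t"
        using y by (simp add: zero_le_mult_iff)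
      moreover have inner: "S - 2 * real k + 45 / 100 - 63664 / 100000 * real n\<^sub>2 = 14016 / 100000"
        using k 1 by simp
      moreover have "real n = y + 7" using nn 1 by (simp add: y_def)
      ultimately show ?thesis unfolding inner using k(1) 1 by (simp add: field_simps)
    next
      case 2
      have "19 * (29352 / 100000) \<le> real n * (29352 / 100000)"
        using n19 by (intro mult_right_mono) auto
      moreover have inner: "S - 2 * real k + 45 / 100 - 63664 / 100000 * real n\<^sub>2 = 29352 / 100000"
        using k 2 by simp
      ultimately show ?thesis unfolding inner using k(1) 2 tn2 by simp
    next
      case 3
      then have n8: "real n\<^sub>2 \<ge> 8" by simp
      then have "19 * (36336 / 100000 * real n\<^sub>2 - 255 / 100) \<le> real n * (36336 / 100000 * real n\<^sub>2 - 255 / 100)"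
        using n19 by (intro mult_right_mono) auto
      moreover have inner: "S - 2 * real k + 45 / 100 - 63664 / 100000 * real n\<^sub>2 = 36336 / 100000 * real n\<^sub>2 - 255 / 100"
        using k 3 by simp
      moreover have "0 \<le> 19 * (36336 / 100000 * real n\<^sub>2 - 255 / 100) + 2 * 2 + 1 - t * real n\<^sub>2"
      proof -
        have "0 \<le> 19 * (36336 / 100000 * N - 255 / 100) + 2 * 2 + 1 - w"
          if "8 \<le> N" "w \<le> 136339 / 100000 * N" for N w :: real using that by simp
        then show ?thesis using n8 tn2 by blast
      qed
      ultimately show ?thesis unfolding inner unfolding k(1) of_nat_numeral by (meson add_right_mono diff_right_mono order_trans)
    qed
  qed
  have "S - real k * (2 - 2 / real n) + 45 / 100 + 1 / real n - 63664 / 100000 * real n\<^sub>2 - t * real n\<^sub>2 / real n =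
      (real n * (S - 2 * real k + 45 / 100 - 63664 / 100000 * real n\<^sub>2) + 2 * real k + 1 - t * real n\<^sub>2) / real n"
    using n19 by (simp add: field_simps)
  also have "\<dots> \<ge> 0" using main by simp
  finally show ?thesis unfolding sig using Pn2 by linarith
qed

theorem tree_join_energy:
  fixes T\<^sub>1 T\<^sub>2 T :: "'a pair_pre_digraph"
  assumes T1: "is_tree T\<^sub>1" "card (pverts T\<^sub>1) = n\<^sub>1"
    and T2: "is_tree T\<^sub>2" "graph_diameter T\<^sub>2 \<le> 3" "card (pverts T\<^sub>2) = n\<^sub>2"
    and n: "n\<^sub>2 \<le> n\<^sub>1" "6 \<le> n\<^sub>2" "n = n\<^sub>1 + n\<^sub>2" "19 \<le> n"
    and disj: "pverts T\<^sub>1 \<inter> pverts T\<^sub>2 = {}" and u: "u \<in> pverts T\<^sub>1" and v: "v \<in> pverts T\<^sub>2"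
    and T: "T = join_by_edge T\<^sub>1 T\<^sub>2 u v" "is_tree T"
    and LE1: "laplacian_energy T\<^sub>1 \<ge> 2 + 4 * real n\<^sub>1 / pi"
  shows "laplacian_energy T \<ge> 4 * real n / pi + 2"
proof -
  note G1 = is_tree_pair_graph[OF T1(1)] and G2 = is_tree_pair_graph[OF T2(1)] and GT = is_tree_pair_graph[OF T(2)]
  interpret two_graphs T\<^sub>1 T\<^sub>2 by (rule two_graphs.intro[OF G1 G2 disj])
  have V: "pverts U = pverts T" unfolding T(1) by (simp add: disjoint_union_def join_by_edge_def)
  have cardT: "card (pverts T) = n"
    unfolding V[symmetric] using T1(2) T2(3) disj finite_pverts[OF G1] finite_pverts[OF G2] n(3)
    by (simp add: disjoint_union_def card_Un_disjoint)
  define P where "P = 2 / pi"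
  have P: "63661 / 100000 \<le> P" "P \<le> 63664 / 100000"
    using pi_bounds pi_gt_zero unfolding P_def by (simp_all add: field_simps)
  define c d where "c = 2 - 2 / real n" and "d = 2 - 2 / real n\<^sub>1"
  have avgT: "average_degree T = c" using tree_average_degree[OF T(2)] by (simp add: cardT c_def)
  have avg1: "average_degree T\<^sub>1 = d" using tree_average_degree[OF T1(1)] by (simp add: T1(2) d_def)
  obtain b\<^sub>1 \<mu>\<^sub>1 where sd1: "spectral_decomposition (pverts T\<^sub>1) (laplacian T\<^sub>1) b\<^sub>1 \<mu>\<^sub>1 n\<^sub>1"
    and ev1: "laplacian_eigenvalues T\<^sub>1 = mset (map \<mu>\<^sub>1 [0..<n\<^sub>1])"
    by (rule laplacian_spectral_decomposition[OF G1, unfolded T1(2)])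
  define n\<^sub>0 where "n\<^sub>0 = card (pverts U)"
  obtain b\<^sub>0 \<mu>\<^sub>0 where sd0: "spectral_decomposition (pverts U) (laplacian U) b\<^sub>0 \<mu>\<^sub>0 n\<^sub>0"
    and "laplacian_eigenvalues U = mset (map \<mu>\<^sub>0 [0..<n\<^sub>0])"
    by (rule laplacian_spectral_decomposition[OF U, folded n\<^sub>0_def])
  obtain b \<mu> where sd: "spectral_decomposition (pverts T) (laplacian T) b \<mu> n"
    and ev: "laplacian_eigenvalues T = mset (map \<mu> [0..<n])"
    by (rule laplacian_spectral_decomposition[OF GT, unfolded cardT])
  have LE: "laplacian_energy T = 2 * (\<Sum>k<n. max 0 (\<mu> k - c))"
    using laplacian_energy_eq(1)[OF GT is_tree_nonempty[OF T(2)], unfolded cardT avgT, OF sd ev] .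
  note le1 = laplacian_energy_eq[OF G1 is_tree_nonempty[OF T1(1)], unfolded T1(2) avg1, OF sd1 ev1]
  \<comment> \<open>The threshold is the average degree d of the first tree, not c, so that the sum
    over \<open>K\<close> is exactly half its energy. Passing from d to c then costs 2/n1 - 2/n for
    each element of \<open>K\<close>.\<close>
  define K where "K = {k. k < n\<^sub>1 \<and> d \<le> \<mu>\<^sub>1 k}"
  have K: "K \<subseteq> {..<n\<^sub>1}" by (auto simp: K_def)
  define \<sigma> where "\<sigma> = real (card K)"
  have sumK: "(\<Sum>k\<in>K. \<mu>\<^sub>1 k - d) = laplacian_energy T\<^sub>1 / 2"
    unfolding le1(1) by (simp, rule sum.mono_neutral_cong_left) (auto simp: K_def)
  have "laplacian_energy T\<^sub>1 / 2 = (\<Sum>k\<in>{..<n\<^sub>1} - K. d - \<mu>\<^sub>1 k)"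
    using sum.subset_diff[OF K, of "\<lambda>k. \<mu>\<^sub>1 k - d"] le1(2) sumK
    by (simp add: sum_subtractf)
  also have "\<dots> \<le> (\<Sum>k\<in>{..<n\<^sub>1} - K. d)"
    using laplacian_eigenvalue_nonneg[OF G1 sd1] by (intro sum_mono) auto
  also have "\<dots> = (real n\<^sub>1 - \<sigma>) * d"
    using K by (simp add: \<sigma>_def card_Diff_subset finite_subset[OF K] of_nat_diff card_mono[OF finite_lessThan K, simplified])
  finally have \<sigma>: "laplacian_energy T\<^sub>1 / 2 \<le> (real n\<^sub>1 - \<sigma>) * d" .
  have LE1': "1 + P * real n\<^sub>1 \<le> laplacian_energy T\<^sub>1 / 2" using LE1 by (simp add: P_def)
  obtain k S where S: "k = 1 \<and> S = real n\<^sub>2 \<or>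
      k = 2 \<and> S = real n\<^sub>2 + 2 - (if n\<^sub>2 = 6 then 49 / 100 else if n\<^sub>2 = 7 then 7 / 10 else 1)"
    and trial: "has_trial_family T\<^sub>2 k S"
    using tree_diameter_3_trial_family[OF T2(1,2) T2(3)[symmetric] n(2)] by blast
  have "(\<Sum>i\<in>K. \<mu>\<^sub>1 i - c) + (S - real k * c) \<le> (\<Sum>i<n\<^sub>0. max 0 (\<mu>\<^sub>0 i - c))"
    by (rule ky_fan_union[OF sd0 sd1 K trial])
  moreover have "(\<Sum>i\<in>K. \<mu>\<^sub>1 i - c) = laplacian_energy T\<^sub>1 / 2 - \<sigma> * (2 / real n\<^sub>1 - 2 / real n)"
    unfolding sumK[symmetric] by (simp add: sum_subtractf \<sigma>_def c_def d_def algebra_simps)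
  moreover have "(\<Sum>k<n\<^sub>0. max 0 (\<mu>\<^sub>0 k - c)) + 45 / 100 + 1 / real n \<le> (\<Sum>k<n. max 0 (\<mu> k - c))"
  proof -
    have x: "0 \<le> 1 / real n" "1 / real n \<le> 6 / 100" using n(4) by (simp_all add: field_simps)
    have J: "pair_graph (join_by_edge T\<^sub>1 T\<^sub>2 u v)" using GT T(1) by simp
    have sdJ: "spectral_decomposition (pverts U) (laplacian (join_by_edge T\<^sub>1 T\<^sub>2 u v)) b \<mu> n"
      using sd unfolding V T(1)[symmetric] .
    have deg\<^sub>1: "\<exists>w. (u, w) \<in> parcs T\<^sub>1"
      by (rule tree_neighbour_exists[OF T1(1) u]) (use T1(2) n in auto)
    have deg\<^sub>2: "\<exists>w. (v, w) \<in> parcs T\<^sub>2"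
      by (rule tree_neighbour_exists[OF T2(1) v]) (use T2(3) n in auto)
    show ?thesis
      using join_energy_gain[OF u v J sd0 sdJ deg\<^sub>1 deg\<^sub>2 x] by (simp add: c_def)
  qed
  moreover have "P * real n\<^sub>2 + \<sigma> * (2 / real n\<^sub>1 - 2 / real n) \<le> S - real k * c + 45 / 100 + 1 / real n"
    using numerical_estimate[OF n(2,1) n(4)[unfolded n(3)] P _ S, of \<sigma>] \<sigma> LE1'
    unfolding c_def n(3) d_def by linarith
  ultimately have "1 + P * real n\<^sub>1 + P * real n\<^sub>2 \<le> (\<Sum>k<n. max 0 (\<mu> k - c))"
    using LE1' by linarith
  then show ?thesis unfolding LE P_def n(3) by (simp add: field_simps)
qed

theorem theorem5p1:
  fixes T\<^sub>1 T\<^sub>2 T :: "'a pair_pre_digraph"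
    and u v :: 'a
    and n\<^sub>1 n\<^sub>2 n r\<^sub>1 \<sigma>\<^sub>1 :: nat
  assumes "is_tree T\<^sub>1" and "card (pverts T\<^sub>1) = n\<^sub>1" and "card (non_pendent T\<^sub>1) = r\<^sub>1"
    and "is_tree T\<^sub>2" and "graph_diameter T\<^sub>2 \<le> 3" and "card (pverts T\<^sub>2) = n\<^sub>2"
    and "n\<^sub>1 \<ge> n\<^sub>2" and "n\<^sub>2 \<ge> 6"
    and "pverts T\<^sub>1 \<inter> pverts T\<^sub>2 = {}"
    and "u \<in> pverts T\<^sub>1" and "v \<in> pverts T\<^sub>2"
    and "T = join_by_edge T\<^sub>1 T\<^sub>2 u v" and "is_tree T"
    and "n = n\<^sub>1 + n\<^sub>2" and "n \<ge> 19"
    and "size {#\<mu> \<in># laplacian_eigenvalues T\<^sub>1. \<mu> \<ge> average_degree T\<^sub>1#} = \<sigma>\<^sub>1"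
    and "\<sigma>\<^sub>1 = r\<^sub>1"
    and "laplacian_energy T\<^sub>1 \<ge> 2 + 4 * real n\<^sub>1 / pi"
  shows "laplacian_energy T \<ge> 4 * real n / pi + 2 \<and>
         laplacian_energy T \<ge> laplacian_energy (path_graph n)"
proof
  show LE: "laplacian_energy T \<ge> 4 * real n / pi + 2"
    by (rule tree_join_energy[OF assms(1,2) assms(4,5,6) assms(7,8) assms(14,15) assms(9,10,11) assms(12,13) assms(18)])
  have "laplacian_energy (path_graph n) \<le> 4 * real n / pi + 2"
    by (rule path_energy_le) (use assms(15) in simp)
  with LE show "laplacian_energy T \<ge> laplacian_energy (path_graph n)"
    by (rule order_trans[rotated])
qed

end
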